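(* Let $a<b$ be real numbers and let $\mu$ be Lebesgue measure on $[a,b]$. Suppose that one of the following conditions holds: (a) $\Phi$ is an $N$-function and $f\in L^\infty([a,b])$; (b) $\Phi$ is an $N_\infty$-function and $f\in L^\Phi([a,b])$. Assume $f\notin M_\Phi$. If $f$ is approximately continuous at every point of $(a,b)$, then $\mu_\Phi(f/M_\Phi)$ is a singleton (as a set of a.e.-equivalence classes).
   Context: Class $\mathcal F$: functions $\varphi:[0,\infty)\to[0,\infty)$ that are non-decreasing, continuous, positive for $t>0$, with $\varphi(0^+)=0$ and $\lim_{t\to\infty}\varphi(t)=\infty$. Class $\mathcal F_\infty$: functions $\varphi:[0,\infty)\to[0,\infty)$ that are bounded, non-decreasing, continuous, positive for $t>0$, with $\varphi(0^+)=0$. An $N$-function (resp. $N_\infty$-function) is a convex function $\Phi(x)=\int_0^x\varphi(t)\,dt$, $x\ge 0$, for some $\varphi\in\mathcal F$ (resp. $\varphi\in\mathcal F_\infty$). All $N$-functions and $N_\infty$-functions are assumed to satisfy the $\Delta_2$ condition: there is a constant $K_2>0$ with $\Phi(2x)\le K_2\Phi(x)$ for all $x\ge 0$. $L^\Phi=L^\Phi([a,b])$ is the space of (a.e.-equivalence classes of) measurable functions $f$ on $[a,b]$ with $\int_a^b\Phi(|f|)\,d\mu<\infty$. $M_\Phi$ is the set of all non-decreasing functions in $L^\Phi([a,b])$ (up to a.e. equality). Pointwise properties of an element of $M_\Phi$ refer to a non-decreasing representative, real-valued on $(a,b)$. For $f\in L^\Phi$, $\mu_\Phi(f/M_\Phi)$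 denotes the set of best $\Phi$-approximants to $f$ from $M_\Phi$, i.e. of all $g^*\in M_\Phi$ with $\int_a^b\Phi(|f-g^*|)\,d\mu=\inf_{g\in M_\Phi}\int_a^b\Phi(|f-g|)\,d\mu$. It is known (Landers and Rogge) that $\mu_\Phi(f/M_\Phi)\neq\emptyset$ for every $f\in L^\Phi([a,b])$ whenever $\Phi$ is convex with $\Phi(0)=0$, $\lim_{t\to\infty}\Phi(t)=\infty$ and the $\Delta_2$ condition. Approximate continuity: a measurable function $f$ on $[a,b]$ (a fixed pointwise-defined function) is approximately continuous at $x_0\in(a,b)$ if for every $\delta>0$ the set $A_\delta=\{x\in[a,b]:|f(x)-f(x_0)|<\delta\}$ has metric density $1$ at $x_0$, that is, $\mu(A_\delta\cap I)/\mu(I)\to 1$ as $\mu(I)\to 0$, where $I$ ranges over the intervals containing $x_0$. *)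

theory Defs
  imports "HOL-Analysis.Analysis"
begin

text \<open>
  Functions on \<open>[0,\<infinity>)\<close> or on \<open>[a,b]\<close> are total functions \<open>real \<Rightarrow> real\<close>; every definition below
  depends only on their values on the relevant domain.
\<close>

definition class_F :: "(real \<Rightarrow> real) set" where
  "class_F = {\<phi>. (\<forall>t\<ge>0. 0 \<le> \<phi> t) \<and> mono_on {0..} \<phi> \<and> continuous_on {0..} \<phi>
     \<and> (\<forall>t>0. 0 < \<phi> t) \<and> (\<phi> \<longlongrightarrow> 0) (at_right 0) \<and> filterlim \<phi> at_top at_top}"

definition class_F_inf :: "(real \<Rightarrow> real) set" where
  "class_F_inf = {\<phi>. (\<forall>t\<ge>0. 0 \<le> \<phi> t) \<and> bounded (\<phi> ` {0..}) \<and> mono_on {0..} \<phi>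
     \<and> continuous_on {0..} \<phi> \<and> (\<forall>t>0. 0 < \<phi> t) \<and> (\<phi> \<longlongrightarrow> 0) (at_right 0)}"

definition N_function :: "(real \<Rightarrow> real) \<Rightarrow> bool" where
  "N_function \<Phi> \<longleftrightarrow> convex_on {0..} \<Phi> \<and> (\<exists>\<phi>\<in>class_F. \<forall>x\<ge>0. \<Phi> x = integral {0..x} \<phi>)"

definition N_inf_function :: "(real \<Rightarrow> real) \<Rightarrow> bool" where
  "N_inf_function \<Phi> \<longleftrightarrow> convex_on {0..} \<Phi> \<and> (\<exists>\<phi>\<in>class_F_inf. \<forall>x\<ge>0. \<Phi> x = integral {0..x} \<phi>)"

definition Delta2 :: "(real \<Rightarrow> real) \<Rightarrow> bool" where
  "Delta2 \<Phi> \<longleftrightarrow> (\<exists>K>0. \<forall>x\<ge>0. \<Phi> (2 * x) \<le> K * \<Phi> x)"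

definition modular :: "real \<Rightarrow> real \<Rightarrow> (real \<Rightarrow> real) \<Rightarrow> (real \<Rightarrow> real) \<Rightarrow> ennreal" where
  "modular a b \<Phi> f = (\<integral>\<^sup>+ x. ennreal (\<Phi> \<bar>f x\<bar>) \<partial>lebesgue_on {a..b})"

definition L_Phi :: "real \<Rightarrow> real \<Rightarrow> (real \<Rightarrow> real) \<Rightarrow> (real \<Rightarrow> real) set" where
  "L_Phi a b \<Phi> = {f \<in> borel_measurable (lebesgue_on {a..b}). modular a b \<Phi> f < \<infinity>}"

definition L_inf :: "real \<Rightarrow> real \<Rightarrow> (real \<Rightarrow> real) set" where
  "L_inf a b = {f \<in> borel_measurable (lebesgue_on {a..b}).
     \<exists>C. AE x in lebesgue_on {a..b}. \<bar>f x\<bar> \<le> C}"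

text \<open>
  The non-decreasing representative is required to be real-valued on the open interval only: a
  non-decreasing function in \<open>L\<^sup>\<Phi>\<close> may be unbounded near an endpoint, and then no real-valued
  representative is non-decreasing on all of \<open>[a,b]\<close>.
\<close>

definition M_Phi :: "real \<Rightarrow> real \<Rightarrow> (real \<Rightarrow> real) \<Rightarrow> (real \<Rightarrow> real) set" where
  "M_Phi a b \<Phi> = {g \<in> L_Phi a b \<Phi>.
     \<exists>h. mono_on {a<..<b} h \<and> (AE x in lebesgue_on {a..b}. g x = h x)}"

definition best_approximants ::
  "real \<Rightarrow> real \<Rightarrow> (real \<Rightarrow> real) \<Rightarrow> (real \<Rightarrow> real) \<Rightarrow> (real \<Rightarrow> real) set" where
  "best_approximants a b \<Phi> f = {g \<in> M_Phi a b \<Phi>.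
     modular a b \<Phi> (\<lambda>x. f x - g x) = (INF h\<in>M_Phi a b \<Phi>. modular a b \<Phi> (\<lambda>x. f x - h x))}"

definition ae_equal :: "real \<Rightarrow> real \<Rightarrow> ((real \<Rightarrow> real) \<times> (real \<Rightarrow> real)) set" where
  "ae_equal a b = {(g, h). g \<in> borel_measurable (lebesgue_on {a..b})
     \<and> h \<in> borel_measurable (lebesgue_on {a..b}) \<and> (AE x in lebesgue_on {a..b}. g x = h x)}"

text \<open>
  The condition \<open>0 < measure lebesgue I\<close> excludes degenerate intervals and also those of infinite
  length, for which \<^const>\<open>measure\<close> is \<open>0\<close> by convention.
\<close>

definition has_metric_density_1 :: "real set \<Rightarrow> real \<Rightarrow> bool" where
  "has_metric_density_1 A x\<^sub>0 \<longleftrightarrow> (\<forall>\<epsilon>>0. \<exists>\<eta>>0. \<forall>I. is_interval I \<longrightarrow> x\<^sub>0 \<in> I \<longrightarrow>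
     0 < measure lebesgue I \<longrightarrow> measure lebesgue I < \<eta> \<longrightarrow>
     \<bar>measure lebesgue (A \<inter> I) / measure lebesgue I - 1\<bar> < \<epsilon>)"

definition approx_continuous_at :: "real \<Rightarrow> real \<Rightarrow> (real \<Rightarrow> real) \<Rightarrow> real \<Rightarrow> bool" where
  "approx_continuous_at a b f x\<^sub>0 \<longleftrightarrow>
     (\<forall>\<delta>>0. has_metric_density_1 {x \<in> {a..b}. \<bar>f x - f x\<^sub>0\<bar> < \<delta>} x\<^sub>0)"

end

theory Submission
  imports Defs "HOL-Complex_Analysis.Great_Picard"
begin

text \<open>
  The proof works with the even function \<open>\<Psi> x = \<Phi> \<bar>x\<bar>\<close>, which is convex and continuously
  differentiable with a derivative \<open>\<psi>\<close> that vanishes only at \<open>0\<close>.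

  Existence of a best approximant is compactness. By the doubling condition a minimizing sequence of
  monotone functions is bounded at every interior point; Helly selection gives a limit outside a
  countable set, and Fatou's lemma shows that the limit is optimal (\<open>optimal_exists\<close>).

  For uniqueness, let \<open>g1\<close> and \<open>g2\<close> be optimal. Although \<open>\<Psi>\<close> need not be strictly convex, optimality of
  the midpoint forces \<open>\<psi>(f - g1) = \<psi>(f - g2)\<close> almost everywhere (\<open>optimal_residuals_agree\<close>). Call this
  common function \<open>p\<close> and put \<open>H t = \<integral>\<^sub>t\<^sup>b p\<close>. First variations within the cone of monotone functions
  give \<open>H \<le> 0\<close>, \<open>H a = H b = 0\<close>, and that \<open>g1\<close> and \<open>g2\<close> are constant on each interval on which
  \<open>H < 0\<close> (\<open>optimal_constant_where_tail_negative\<close>).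

  Where \<open>g1 < g2\<close>, equality of the two residual derivatives says that \<open>f\<close> avoids \<open>[g1,g2]\<close>. An
  approximately continuous function has the Darboux property, even in the strong form that a gap in
  its values modulo null sets confines it to one side
  (\<open>approx_continuous_ae_gap_imp_one_sided\<close>). If \<open>g1 < g2\<close> at a common point of continuity, this makes
  \<open>H\<close> negative there; on the surrounding component of \<open>{H < 0}\<close> both approximants are constant, so \<open>f\<close>
  stays on one side of both, \<open>p\<close> has constant sign, and \<open>H\<close> is monotone between two of its zeros.
  This is impossible (\<open>optimal_not_less\<close>).
\<close>

section \<open>The Darboux property of approximately continuous functions\<close>

lemma DERIV_sign_change_imp_zero:
  fixes G D :: "real \<Rightarrow> real"
  assumes "u < v" and der: "\<And>x. x \<in> {u..v} \<Longrightarrow> (G has_real_derivative D x) (at x)"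
    and "D u > 0" "D v < 0"
  shows "\<exists>z. u < z \<and> z < v \<and> D z = 0"
proof -
  have "continuous_on {u..v} G"
    using der by (intro continuous_at_imp_continuous_on ballI) (blast intro: DERIV_isCont)
  then obtain z where z: "z \<in> {u..v}" and zmax: "\<And>y. y \<in> {u..v} \<Longrightarrow> G y \<le> G z"
    using continuous_attains_sup[of "{u..v}" G] \<open>u < v\<close> by auto
  have "z \<noteq> u"
  proof
    assume "z = u"
    obtain d where d: "d > 0" "\<forall>h>0. h < d \<longrightarrow> G u < G (u + h)"
      using DERIV_pos_inc_right[OF der[of u] \<open>D u > 0\<close>] \<open>u < v\<close> by auto
    define h where "h = min (d / 2) (v - u)"
    have "G u < G (u + h)" using d \<open>u < v\<close> by (auto simp: h_def)
    moreover have "u + h \<in> {u..v}" using d \<open>u < v\<close> by (auto simp: h_def)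
    ultimately show False using zmax \<open>z = u\<close> by fastforce
  qed
  moreover have "z \<noteq> v"
  proof
    assume "z = v"
    obtain d where d: "d > 0" "\<forall>h>0. h < d \<longrightarrow> G v < G (v - h)"
      using DERIV_neg_dec_left[OF der[of v] \<open>D v < 0\<close>] \<open>u < v\<close> by auto
    define h where "h = min (d / 2) (v - u)"
    have "G v < G (v - h)" using d \<open>u < v\<close> by (auto simp: h_def)
    moreover have "v - h \<in> {u..v}" using d \<open>u < v\<close> by (auto simp: h_def)
    ultimately show False using zmax \<open>z = v\<close> by fastforce
  qed
  ultimately have "u < z" "z < v" using z by auto
  moreover have "D z = 0"
  proof (rule DERIV_local_max[OF der[OF z]])
    show "0 < min (z - u) (v - z)" using \<open>u < z\<close> \<open>z < v\<close> by simp
    show "\<forall>y. \<bar>z - y\<bar> < min (z - u) (v - z) \<longrightarrow> G y \<le> G z"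
      using zmax by (auto simp: abs_if split: if_splits)
  qed
  ultimately show ?thesis by blast
qed

text \<open>
  Derivatives have the intermediate value property, so a derivative without zeros cannot change sign.
\<close>

lemma DERIV_nonzero_imp_constant_sign:
  fixes G D :: "real \<Rightarrow> real"
  assumes der: "\<And>x. x \<in> {p<..<q} \<Longrightarrow> (G has_real_derivative D x) (at x)"
    and nz: "\<And>x. x \<in> {p<..<q} \<Longrightarrow> D x \<noteq> 0"
  shows "(\<forall>x\<in>{p<..<q}. D x > 0) \<or> (\<forall>x\<in>{p<..<q}. D x < 0)"
proof (rule ccontr)
  assume "\<not> ?thesis"
  then obtain x y where xy: "x \<in> {p<..<q}" "y \<in> {p<..<q}" "D x > 0" "D y < 0"
    using nz by (meson linorder_neqE_linordered_idom)
  then consider "x < y" | "y < x" by (cases x y rule: linorder_cases) auto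
  then show False
  proof cases
    case 1
    then obtain z where "x < z" "z < y" "D z = 0"
      using DERIV_sign_change_imp_zero[of x y G D] der xy by force
    then show False using nz xy by force
  next
    case 2
    have "((\<lambda>x. - G x) has_real_derivative - D t) (at t)" if "t \<in> {y..x}" for t
      using DERIV_minus[OF der[of t]] that xy by force
    then obtain z where "y < z" "z < x" "D z = 0"
      using DERIV_sign_change_imp_zero[of y x "\<lambda>x. - G x" "\<lambda>x. - D x"] 2 xy by force
    then show False using nz xy by force
  qed
qed

lemma AE_lebesgue_on_iff:
  "(AE x in lebesgue_on {a..b::real}. P x) \<longleftrightarrow> (AE x in lebesgue. x \<in> {a..b} \<longrightarrow> P x)"
  by (subst AE_restrict_space_iff) auto

lemma AE_lebesgue_on_interval_witness:
  fixes a b u v :: real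
  assumes "AE x in lebesgue_on {a..b}. P x" "a \<le> u" "u < v" "v \<le> b"
  shows "\<exists>x\<in>{u<..<v}. P x"
proof (rule ccontr)
  assume no: "\<not> ?thesis"
  have "AE x in lebesgue. x \<in> {a..b} \<longrightarrow> P x"
    using assms(1) unfolding AE_lebesgue_on_iff .
  then have "AE x in lebesgue. x \<notin> {u<..<v}"
    by eventually_elim (use no assms in force)
  then have "{u<..<v} \<in> null_sets lebesgue"
    by (subst (asm) AE_iff_null_sets[symmetric]) auto
  then have "measure lebesgue {u<..<v} = 0"
    by (simp add: measure_eq_0_null_sets)
  then show False using \<open>u < v\<close> by simp
qed

text \<open>
  An approximately continuous function cannot jump across a gap \<open>(c,d)\<close> in its essential range.
  Put \<open>E = {f \<le> c}\<close>. A value inside the gap would force values near it on a set of positive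
  measure, so there is none, and then every point of the interval is a density point of \<open>E\<close> or of its complement.
  Hence the function \<open>F x = \<mu> (E \<inter> [p,x])\<close> is differentiable everywhere with \<open>F' = 1\<close> on \<open>E\<close> and
  \<open>F' = 0\<close> off \<open>E\<close>. By Darboux's theorem, \<open>F'\<close> is constant.
\<close>

lemma approx_continuous_ae_gap_imp_one_sided:
  fixes f :: "real \<Rightarrow> real"
  assumes meas: "f \<in> borel_measurable (lebesgue_on {a..b})"
    and pq: "a \<le> p" "p < q" "q \<le> b"
    and ac: "\<And>x. x \<in> {p<..<q} \<Longrightarrow> approx_continuous_at a b f x"
    and "c < d"
    and gap: "AE x in lebesgue_on {a..b}. x \<in> {p<..<q} \<longrightarrow> f x \<le> c \<or> d \<le> f x"
  shows "(\<forall>x\<in>{p<..<q}. f x \<le> c) \<or> (\<forall>x\<in>{p<..<q}. d \<le> f x)"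
proof -
  define A where "A x \<delta> = {y \<in> {a..b}. \<bar>f y - f x\<bar> < \<delta>}" for x \<delta>
  define E where "E = {y \<in> {a..b}. f y \<le> c} \<inter> {p<..<q}"
  have meas_set: "{y \<in> {a..b}. f y \<in> S} \<in> sets lebesgue" if "S \<in> sets borel" for S
  proof -
    have "f -` S \<inter> space (lebesgue_on {a..b}) \<in> sets (lebesgue_on {a..b})"
      using meas that by (rule measurable_sets)
    moreover have "f -` S \<inter> space (lebesgue_on {a..b}) = {y \<in> {a..b}. f y \<in> S}"
      by auto
    ultimately show ?thesis
      by (simp add: sets_restrict_space_iff)
  qed
  have A_meas: "A x \<delta> \<in> sets lebesgue" for x \<delta>
    using meas_set[of "{f x - \<delta><..<f x + \<delta>}"]
    by (rule back_subst[where P="\<lambda>s. s \<in> sets lebesgue"]) (auto simp: A_def)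
  have E_meas: "E \<in> sets lebesgue"
    using meas_set[of "{..c}"] unfolding E_def by (auto intro!: sets.Int)
  have lm: "S \<inter> {u..v} \<in> lmeasurable" if "S \<in> sets lebesgue" for S :: "real set" and u v
    using fmeasurable_Int_fmeasurable[of "{u..v}" lebesgue S] that by (simp add: Int_commute)
  \<comment> \<open>Metric density, read off on compact intervals around the point.\<close>
  have dens: "\<exists>\<eta>>0. \<forall>u v. u \<le> x \<longrightarrow> x \<le> v \<longrightarrow> u < v \<longrightarrow> v - u < \<eta> \<longrightarrow>
      \<bar>measure lebesgue (A x \<delta> \<inter> {u..v}) / (v - u) - 1\<bar> < \<epsilon>"
    if x: "x \<in> {p<..<q}" and "\<delta> > 0" "\<epsilon> > 0" for x \<delta> \<epsilon>
  proof -
    have "has_metric_density_1 (A x \<delta>) x"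
      using ac[OF x] \<open>\<delta> > 0\<close> by (simp add: approx_continuous_at_def A_def)
    then obtain \<eta> where "\<eta> > 0" and \<eta>: "\<And>I. is_interval I \<Longrightarrow> x \<in> I \<Longrightarrow>
        0 < measure lebesgue I \<Longrightarrow> measure lebesgue I < \<eta> \<Longrightarrow>
        \<bar>measure lebesgue (A x \<delta> \<inter> I) / measure lebesgue I - 1\<bar> < \<epsilon>"
      using \<open>\<epsilon> > 0\<close> by (auto simp: has_metric_density_1_def)
    have "\<bar>measure lebesgue (A x \<delta> \<inter> {u..v}) / (v - u) - 1\<bar> < \<epsilon>"
      if "u \<le> x" "x \<le> v" "u < v" "v - u < \<eta>" for u v
      using \<eta>[of "{u..v}"] that by (simp add: is_interval_cc)
    then show ?thesis using \<open>\<eta> > 0\<close> by blast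
  qed
  have gap_everywhere: "f x \<le> c \<or> d \<le> f x" if x: "x \<in> {p<..<q}" for x
  proof (rule ccontr)
    assume "\<not> ?thesis"
    then have cfd: "c < f x" "f x < d" by auto
    define \<delta> where "\<delta> = min (f x - c) (d - f x)"
    obtain \<eta> where "\<eta> > 0" and \<eta>: "\<And>u v. u \<le> x \<Longrightarrow> x \<le> v \<Longrightarrow> u < v \<Longrightarrow> v - u < \<eta> \<Longrightarrow>
        \<bar>measure lebesgue (A x \<delta> \<inter> {u..v}) / (v - u) - 1\<bar> < 1"
      using dens[OF x, of \<delta> 1] cfd by (auto simp: \<delta>_def)
    define v where "v = min (x + \<eta> / 2) ((x + q) / 2)"
    have v: "x < v" "v < q" "v - x < \<eta>" using x \<open>\<eta> > 0\<close> by (auto simp: v_def min_def)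
    have "AE y in lebesgue. y \<notin> A x \<delta> \<inter> {x..v}"
      using gap[unfolded AE_lebesgue_on_iff]
      by eventually_elim (use x v pq in \<open>auto simp: A_def \<delta>_def abs_less_iff\<close>)
    then have "A x \<delta> \<inter> {x..v} \<in> null_sets lebesgue"
      using lm[OF A_meas] by (subst (asm) AE_iff_null_sets[symmetric]) (auto dest: fmeasurableD)
    then have "measure lebesgue (A x \<delta> \<inter> {x..v}) = 0"
      by (simp add: measure_eq_0_null_sets)
    then show False using \<eta>[of x v] v by simp
  qed
  define F where "F x = integral {p..x} (indicat_real E)" for x
  define D :: "real \<Rightarrow> real" where "D x = (if f x \<le> c then 1 else 0)" for x
  have ind_int: "indicat_real E integrable_on {u..v}" for u v
    using integrable_on_indicator lm[OF E_meas] by blast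
  have F_diff: "F v - F u = measure lebesgue (E \<inter> {u..v})" if "p \<le> u" "u \<le> v" for u v
  proof -
    have "F u + integral {u..v} (indicat_real E) = F v"
      unfolding F_def using that ind_int by (intro Henstock_Kurzweil_Integration.integral_combine) auto
    then show ?thesis using integral_indicator[OF lm[OF E_meas]] by simp
  qed
  have quotient: "\<exists>\<eta>>0. \<forall>u v. u \<le> x \<longrightarrow> x \<le> v \<longrightarrow> u < v \<longrightarrow> v - u < \<eta> \<longrightarrow>
      \<bar>(F v - F u) / (v - u) - D x\<bar> < \<epsilon>"
    if x: "x \<in> {p<..<q}" and "\<epsilon> > 0" for x \<epsilon>
  proof -
    obtain \<eta> where "\<eta> > 0" and \<eta>: "\<And>u v. u \<le> x \<Longrightarrow> x \<le> v \<Longrightarrow> u < v \<Longrightarrow> v - u < \<eta> \<Longrightarrow>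
        \<bar>measure lebesgue (A x (d - c) \<inter> {u..v}) / (v - u) - 1\<bar> < \<epsilon>"
      using dens[OF x, of "d - c" \<epsilon>] \<open>c < d\<close> \<open>\<epsilon> > 0\<close> by auto
    define \<eta>' where "\<eta>' = min \<eta> (min (x - p) (q - x))"
    have "\<bar>(F v - F u) / (v - u) - D x\<bar> < \<epsilon>"
      if uv: "u \<le> x" "x \<le> v" "u < v" "v - u < \<eta>'" for u v
    proof -
      have sub: "{u..v} \<subseteq> {p<..<q}" using uv by (auto simp: \<eta>'_def)
      have sub': "{u..v} \<subseteq> {a..b}" using sub pq by fastforce
      let ?m = "\<lambda>S. measure lebesgue (S \<inter> {u..v})"
      have dA: "\<bar>?m (A x (d - c)) / (v - u) - 1\<bar> < \<epsilon>" using \<eta> uv by (auto simp: \<eta>'_def)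
      have Fm: "F v - F u = ?m E" using F_diff[of u v] sub uv by force
      have Ele: "?m E \<le> v - u"
        using measure_mono_fmeasurable[of "E \<inter> {u..v}" "{u..v}" lebesgue] lm[OF E_meas] uv
        by (auto dest: fmeasurableD)
      show ?thesis
      proof (cases "f x \<le> c")
        case True
        have "A x (d - c) \<inter> {u..v} \<subseteq> E \<inter> {u..v}"
          using gap_everywhere sub True by (fastforce simp: A_def E_def abs_less_iff)
        then have "?m (A x (d - c)) \<le> ?m E"
          by (intro measure_mono_fmeasurable lm E_meas) (use lm[OF A_meas] in \<open>auto dest: fmeasurableD\<close>)
        then have "?m (A x (d - c)) / (v - u) \<le> ?m E / (v - u)" "?m E / (v - u) \<le> 1"
          using Ele uv by (auto simp: divide_right_mono)
        then show ?thesis using dA True Fm by (auto simp: D_def)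
      next
        case False
        then have "f x \<ge> d" using gap_everywhere[OF x] by auto
        then have dis: "(A x (d - c) \<inter> {u..v}) \<inter> (E \<inter> {u..v}) = {}"
          by (auto simp: A_def E_def abs_less_iff)
        have "?m (A x (d - c)) + ?m E = measure lebesgue (A x (d - c) \<inter> {u..v} \<union> E \<inter> {u..v})"
          using measure_Un2[of "A x (d - c) \<inter> {u..v}" lebesgue "E \<inter> {u..v}"] lm A_meas E_meas dis
          by (metis Diff_triv Int_commute)
        also have "\<dots> \<le> measure lebesgue {u..v}"
          using lm[OF E_meas] lm[OF A_meas]
          by (intro measure_mono_fmeasurable) (auto dest: fmeasurableD intro!: sets.Un)
        finally have "?m (A x (d - c)) + ?m E \<le> v - u" using uv by simp
        then have "?m (A x (d - c)) / (v - u) + ?m E / (v - u) \<le> 1"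
          using uv by (simp add: add_divide_distrib[symmetric])
        then have "?m E / (v - u) < \<epsilon>" using dA by linarith
        then show ?thesis using uv False Fm by (simp add: D_def)
      qed
    qed
    moreover have "\<eta>' > 0" using \<open>\<eta> > 0\<close> x by (auto simp: \<eta>'_def)
    ultimately show ?thesis by blast
  qed
  have F_deriv: "(F has_real_derivative D x) (at x)" if x: "x \<in> {p<..<q}" for x
    unfolding DERIV_def
  proof (rule LIM_I)
    fix \<epsilon> :: real assume "\<epsilon> > 0"
    obtain \<eta> where "\<eta> > 0" and \<eta>: "\<And>u v. u \<le> x \<Longrightarrow> x \<le> v \<Longrightarrow> u < v \<Longrightarrow> v - u < \<eta> \<Longrightarrow>
        \<bar>(F v - F u) / (v - u) - D x\<bar> < \<epsilon>"
      using quotient[OF x \<open>\<epsilon> > 0\<close>] by blast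
    have "\<bar>(F (x + h) - F x) / h - D x\<bar> < \<epsilon>" if "h \<noteq> 0" "\<bar>h\<bar> < \<eta>" for h
    proof (cases "h > 0")
      case True
      then show ?thesis using \<eta>[of x "x + h"] that by simp
    next
      case False
      then show ?thesis using \<eta>[of "x + h" x] that
        by (simp add: divide_simps algebra_simps split: if_splits)
    qed
    then show "\<exists>s>0. \<forall>h. h \<noteq> 0 \<and> norm (h - 0) < s \<longrightarrow> norm ((F (x + h) - F x) / h - D x) < \<epsilon>"
      using \<open>\<eta> > 0\<close> by (intro exI[of _ \<eta>]) auto
  qed
  \<comment> \<open>Subtracting \<open>1/2\<close> turns the two possible slopes into opposite signs.\<close>
  have "(\<forall>x\<in>{p<..<q}. D x - 1/2 > 0) \<or> (\<forall>x\<in>{p<..<q}. D x - 1/2 < 0)"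
  proof (rule DERIV_nonzero_imp_constant_sign)
    show "((\<lambda>x. F x - x / 2) has_real_derivative D x - 1/2) (at x)" if "x \<in> {p<..<q}" for x
      using F_deriv[OF that] by (auto intro!: derivative_eq_intros)
    show "D x - 1/2 \<noteq> 0" for x by (simp add: D_def)
  qed
  then show ?thesis
    using gap_everywhere by (auto simp: D_def split: if_splits)
qed

section \<open>Even differentiable convex gauges\<close>

text \<open>
  The locale collects what the argument needs of \<open>\<Psi> x = \<Phi> \<bar>x\<bar>\<close> and its derivative \<open>\<psi>\<close>: convexity,
  written as the subgradient inequality, continuity of the derivative, a unique minimum at \<open>0\<close>, and
  the doubling condition. Both \<open>N\<close>-functions and \<open>N\<^sub>\<infinity>\<close>-functions give rise to such a pair.
\<close>

locale smooth_gauge =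
  fixes \<Psi> \<psi> :: "real \<Rightarrow> real" and K :: real
  assumes subgradient: "\<Psi> x + \<psi> x * (y - x) \<le> \<Psi> y"
    and \<psi>_continuous: "continuous_on UNIV \<psi>"
    and \<psi>_eq_0_iff: "\<psi> x = 0 \<longleftrightarrow> x = 0"
    and \<Psi>_0: "\<Psi> 0 = 0"
    and \<Psi>_even: "\<Psi> (- x) = \<Psi> x"
    and \<Psi>_double: "\<Psi> (2 * x) \<le> K * \<Psi> x"
begin

lemma \<psi>_mono: "x \<le> y \<Longrightarrow> \<psi> x \<le> \<psi> y"
proof (cases "x = y")
  case False
  assume "x \<le> y"
  have "\<psi> x * (y - x) \<le> \<psi> y * (y - x)"
    using subgradient[of x y] subgradient[of y x] by (simp add: algebra_simps)
  then show ?thesis using False \<open>x \<le> y\<close> by (simp add: mult_le_cancel_right)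
qed simp

lemma \<psi>_pos: "0 < x \<Longrightarrow> 0 < \<psi> x"
  using \<psi>_mono[of 0 x] \<psi>_eq_0_iff[of 0] \<psi>_eq_0_iff[of x] by force

lemma \<psi>_neg: "x < 0 \<Longrightarrow> \<psi> x < 0"
  using \<psi>_mono[of x 0] \<psi>_eq_0_iff[of 0] \<psi>_eq_0_iff[of x] by force

lemma \<Psi>_nonneg: "0 \<le> \<Psi> x"
  using subgradient[of 0 x] \<psi>_eq_0_iff[of 0] \<Psi>_0 by simp

lemma \<Psi>_convex: "convex_on UNIV \<Psi>"
proof (rule convex_onI)
  fix t x y :: real
  assume t: "0 < t" "t < 1"
  define z where "z = (1 - t) *\<^sub>R x + t *\<^sub>R y"
  have "(1 - t) * (\<Psi> z + \<psi> z * (x - z)) + t * (\<Psi> z + \<psi> z * (y - z)) \<le> (1 - t) * \<Psi> x + t * \<Psi> y"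
    using t by (intro add_mono mult_left_mono subgradient) auto
  moreover have "(1 - t) * (\<Psi> z + \<psi> z * (x - z)) + t * (\<Psi> z + \<psi> z * (y - z)) = \<Psi> z"
    by (simp add: z_def algebra_simps)
  ultimately show "\<Psi> ((1 - t) *\<^sub>R x + t *\<^sub>R y) \<le> (1 - t) * \<Psi> x + t * \<Psi> y"
    by (simp add: z_def)
qed auto

lemma \<Psi>_continuous: "continuous_on UNIV \<Psi>"
  using \<Psi>_convex by (intro convex_on_continuous) auto

lemma \<Psi>_borel: "\<Psi> \<in> borel_measurable borel"
  using \<Psi>_continuous by (rule borel_measurable_continuous_onI)

lemma \<psi>_borel: "\<psi> \<in> borel_measurable borel"
  using \<psi>_continuous by (rule borel_measurable_continuous_onI)

lemmas \<Psi>_measurable [measurable] = measurable_compose[OF _ \<Psi>_borel]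

lemmas \<psi>_measurable [measurable] = measurable_compose[OF _ \<psi>_borel]

lemma \<Psi>_midpoint: "\<Psi> ((x + y) / 2) \<le> (\<Psi> x + \<Psi> y) / 2"
  using subgradient[of "(x + y) / 2" x] subgradient[of "(x + y) / 2" y]
  by (simp add: field_simps)

lemma \<Psi>_abs: "\<Psi> \<bar>x\<bar> = \<Psi> x"
  by (simp add: abs_if \<Psi>_even)

lemma \<Psi>_mono_abs: "\<bar>x\<bar> \<le> \<bar>y\<bar> \<Longrightarrow> \<Psi> x \<le> \<Psi> y"
proof -
  assume le: "\<bar>x\<bar> \<le> \<bar>y\<bar>"
  have "0 \<le> \<psi> \<bar>x\<bar>" using \<psi>_mono[of 0 "\<bar>x\<bar>"] \<psi>_eq_0_iff[of 0] by simp
  then have "0 \<le> \<psi> \<bar>x\<bar> * (\<bar>y\<bar> - \<bar>x\<bar>)" using le by simp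
  then show ?thesis using subgradient[of "\<bar>x\<bar>" "\<bar>y\<bar>"] by (simp add: \<Psi>_abs)
qed

lemma \<Psi>_add_le: "\<Psi> (x + y) \<le> K / 2 * (\<Psi> x + \<Psi> y)"
proof -
  have "\<Psi> (x + y) \<le> (\<Psi> (2 * x) + \<Psi> (2 * y)) / 2"
  proof -
    have "(2 * x + 2 * y) / 2 = x + y" by simp
    then show ?thesis using \<Psi>_midpoint[of "2 * x" "2 * y"] by (simp only:)
  qed
  also have "\<dots> \<le> (K * \<Psi> x + K * \<Psi> y) / 2"
    using \<Psi>_double[of x] \<Psi>_double[of y] by simp
  also have "\<dots> = K / 2 * (\<Psi> x + \<Psi> y)" by (simp add: algebra_simps)
  finally show ?thesis .
qed

lemma \<Psi>_linear_growth: "\<psi> 1 * (\<bar>y\<bar> - 1) \<le> \<Psi> y"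
  using subgradient[of 1 "\<bar>y\<bar>"] \<Psi>_nonneg[of 1] by (simp add: \<Psi>_abs)

lemma K_pos: "0 < K"
proof -
  have "0 < \<Psi> 2" using \<Psi>_linear_growth[of 2] \<psi>_pos[of 1] by simp
  also have "\<dots> \<le> K * \<Psi> 1" using \<Psi>_double[of 1] by simp
  finally show ?thesis using \<Psi>_nonneg[of 1] by (simp add: zero_less_mult_iff)
qed

text \<open>
  The doubling condition bounds the derivative by the gauge, since
  \<open>x \<psi>(x) \<le> \<Psi>(2x) - \<Psi>(x)\<close>. This makes \<open>\<psi> \<circ> u\<close> integrable as soon as \<open>\<Psi> \<circ> u\<close> is.
\<close>

lemma \<psi>_abs_le: "\<bar>\<psi> x\<bar> \<le> (\<psi> 1 - \<psi> (- 1)) + K * \<Psi> x"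
proof (cases "\<bar>x\<bar> \<le> 1")
  case True
  then have "\<psi> (- 1) \<le> \<psi> x" "\<psi> x \<le> \<psi> 1" by (auto intro!: \<psi>_mono)
  moreover have "\<psi> (- 1) < 0" "0 < \<psi> 1" by (auto intro: \<psi>_neg \<psi>_pos)
  moreover have "0 \<le> K * \<Psi> x" using \<Psi>_double[of x] \<Psi>_nonneg[of "2 * x"] by linarith
  ultimately show ?thesis by (auto simp: abs_if)
next
  case False
  have "\<bar>\<psi> x\<bar> \<le> \<bar>\<psi> x\<bar> * \<bar>x\<bar>" using False by (simp add: mult_le_cancel_left1)
  also have "\<dots> = \<psi> x * x"
    using \<psi>_pos[of x] \<psi>_neg[of x] by (cases x "0 :: real" rule: linorder_cases) auto
  also have "\<dots> \<le> K * \<Psi> x"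
    using subgradient[of x "2 * x"] \<Psi>_double[of x] \<Psi>_nonneg[of x] by simp
  finally show ?thesis using \<psi>_neg[of "-1"] \<psi>_pos[of 1] by simp
qed

text \<open>
  If the tangent at \<open>m\<close> touches the graph again at \<open>u\<close>, then \<open>\<psi> m\<close> is a subgradient at \<open>u\<close> as well,
  and by continuity of \<open>\<psi>\<close> the subgradient at \<open>u\<close> is unique.
\<close>

lemma \<psi>_eq_if_tangent:
  assumes "\<Psi> u = \<Psi> m + \<psi> m * (u - m)"
  shows "\<psi> u = \<psi> m"
proof -
  have *: "(\<psi> m - \<psi> w) * (w - u) \<le> 0" for w
    using subgradient[of m w] subgradient[of w u] assms by (simp add: algebra_simps)
  have right: "\<psi> m \<le> \<psi> (u + inverse (real (Suc n)))" for n
    using *[of "u + inverse (real (Suc n))"] by (simp add: mult_le_0_iff)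
  have left: "\<psi> (u - inverse (real (Suc n))) \<le> \<psi> m" for n
    using *[of "u - inverse (real (Suc n))"] by (simp add: zero_le_mult_iff)
  have cont: "isCont \<psi> u" using \<psi>_continuous by (simp add: continuous_on_eq_continuous_at)
  have "(\<lambda>n. u + inverse (real (Suc n))) \<longlonglongrightarrow> u + 0" "(\<lambda>n. u - inverse (real (Suc n))) \<longlonglongrightarrow> u - 0"
    by (intro tendsto_intros LIMSEQ_inverse_real_of_nat)+
  then have "(\<lambda>n. \<psi> (u + inverse (real (Suc n)))) \<longlonglongrightarrow> \<psi> u" "(\<lambda>n. \<psi> (u - inverse (real (Suc n)))) \<longlonglongrightarrow> \<psi> u"
    using isCont_tendsto_compose[OF cont] by auto
  then have "\<psi> m \<le> \<psi> u" "\<psi> u \<le> \<psi> m"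
    using right left by (auto intro: LIMSEQ_le_const LIMSEQ_le_const2)
  then show ?thesis by simp
qed

text \<open>
  This replaces strict convexity: equality in the midpoint inequality does not force the two points to
  coincide, but it forces the gauge to be affine between them.
\<close>

lemma \<psi>_eq_if_midpoint_eq:
  assumes "\<Psi> ((u + v) / 2) = (\<Psi> u + \<Psi> v) / 2"
  shows "\<psi> u = \<psi> v"
proof -
  define m where "m = (u + v) / 2"
  define t where "t = \<psi> m * (u - m)"
  have "v - m = - (u - m)" by (simp add: m_def field_simps)
  then have t': "\<psi> m * (v - m) = - t" unfolding t_def by (simp only: mult_minus_right)
  have "\<Psi> m + t \<le> \<Psi> u" "\<Psi> m - t \<le> \<Psi> v"
    using subgradient[of m u] subgradient[of m v] t' by (simp_all add: t_def)
  moreover have "2 * \<Psi> m = \<Psi> u + \<Psi> v" using assms by (simp add: m_def)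
  ultimately have "\<Psi> u = \<Psi> m + t" "\<Psi> v = \<Psi> m - t" by linarith+
  then show ?thesis using \<psi>_eq_if_tangent[of u m] \<psi>_eq_if_tangent[of v m] t' by (simp add: t_def)
qed

end

section \<open>Best monotone approximants and their first-order conditions\<close>

locale monotone_approximation = smooth_gauge +
  fixes a b :: real and f :: "real \<Rightarrow> real"
  assumes a_less_b: "a < b"
    and f_measurable [measurable]: "f \<in> borel_measurable (lebesgue_on {a..b})"
    and f_integrable: "integrable (lebesgue_on {a..b}) (\<lambda>x. \<Psi> (f x))"
begin

abbreviation M :: "real measure" where "M \<equiv> lebesgue_on {a..b}"

sublocale finite_measure M
  by (rule finite_measure_lebesgue_on) auto

text \<open>
  The competitors are genuine monotone functions rather than classes modulo null sets; the transition
  to the latter is made only at the end.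
\<close>

definition admissible :: "(real \<Rightarrow> real) \<Rightarrow> bool" where
  "admissible g \<longleftrightarrow> mono_on {a<..<b} g \<and> g \<in> borel_measurable M \<and> integrable M (\<lambda>x. \<Psi> (g x))"

definition err :: "(real \<Rightarrow> real) \<Rightarrow> real" where
  "err g = (LINT x|M. \<Psi> (f x - g x))"

definition optimal :: "(real \<Rightarrow> real) \<Rightarrow> bool" where
  "optimal g \<longleftrightarrow> admissible g \<and> (\<forall>h. admissible h \<longrightarrow> err g \<le> err h)"

lemma integrable_\<Psi>_add:
  assumes [measurable]: "u \<in> borel_measurable M" "v \<in> borel_measurable M"
    and "integrable M (\<lambda>x. \<Psi> (u x))" "integrable M (\<lambda>x. \<Psi> (v x))"
  shows "integrable M (\<lambda>x. \<Psi> (u x + v x))"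
proof (rule Bochner_Integration.integrable_bound)
  show "integrable M (\<lambda>x. K / 2 * (\<Psi> (u x) + \<Psi> (v x)))"
    using assms by simp
  show "AE x in M. norm (\<Psi> (u x + v x)) \<le> norm (K / 2 * (\<Psi> (u x) + \<Psi> (v x)))"
  proof (rule AE_I2)
    fix x
    show "norm (\<Psi> (u x + v x)) \<le> norm (K / 2 * (\<Psi> (u x) + \<Psi> (v x)))"
      unfolding real_norm_def abs_of_nonneg[OF \<Psi>_nonneg]
      by (rule order_trans[OF \<Psi>_add_le abs_ge_self])
  qed
qed (intro \<Psi>_measurable borel_measurable_add assms)

lemma integrable_\<Psi>_diff:
  assumes "u \<in> borel_measurable M" "v \<in> borel_measurable M"
    and "integrable M (\<lambda>x. \<Psi> (u x))" "integrable M (\<lambda>x. \<Psi> (v x))"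
  shows "integrable M (\<lambda>x. \<Psi> (u x - v x))"
  using integrable_\<Psi>_add[of u "\<lambda>x. - v x"] assms by (simp add: \<Psi>_even)

lemma integrable_\<Psi>_bounded:
  assumes [measurable]: "k \<in> borel_measurable M" and "\<And>x. \<bar>k x\<bar> \<le> C"
  shows "integrable M (\<lambda>x. \<Psi> (k x))"
proof (rule Bochner_Integration.integrable_bound)
  show "integrable M (\<lambda>x. \<Psi> C)" by simp
  have "\<Psi> (k x) \<le> \<Psi> C" for x using assms(2)[of x] by (intro \<Psi>_mono_abs) linarith
  then show "AE x in M. norm (\<Psi> (k x)) \<le> norm (\<Psi> C)" by (simp add: \<Psi>_nonneg)
qed (intro \<Psi>_measurable assms)

lemma integrable_\<psi>:
  assumes [measurable]: "u \<in> borel_measurable M" and "integrable M (\<lambda>x. \<Psi> (u x))"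
  shows "integrable M (\<lambda>x. \<psi> (u x))"
proof (rule Bochner_Integration.integrable_bound)
  show "integrable M (\<lambda>x. (\<psi> 1 - \<psi> (- 1)) + K * \<Psi> (u x))"
    using assms by simp
  show "AE x in M. norm (\<psi> (u x)) \<le> norm ((\<psi> 1 - \<psi> (- 1)) + K * \<Psi> (u x))"
    unfolding real_norm_def by (intro AE_I2 order_trans[OF \<psi>_abs_le abs_ge_self])
qed (intro \<psi>_measurable assms)

lemma admissible_err_integrable: "admissible g \<Longrightarrow> integrable M (\<lambda>x. \<Psi> (f x - g x))"
  unfolding admissible_def by (intro integrable_\<Psi>_diff f_measurable f_integrable) auto

lemma err_nonneg: "0 \<le> err g"
  unfolding err_def by (intro Bochner_Integration.integral_nonneg \<Psi>_nonneg)

text \<open>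
  The first-order condition for perturbing \<open>g\<close> in a direction \<open>k'\<close>. The perturbation of size
  \<open>1/(n+1)\<close> uses its own direction \<open>k n\<close>, because the directions needed below are discontinuous
  functions of \<open>g\<close>, and only suitable approximations of them keep \<open>g\<close> monotone. The subgradient
  inequality at the perturbed function bounds the change of the error by
  \<open>-1/(n+1)\<close> times the integral of \<open>\<psi>\<close> of the perturbed residual times \<open>k n\<close>. By optimality this
  integral is at most \<open>0\<close>, and dominated convergence passes to the limit.
\<close>

lemma optimal_variation:
  fixes k :: "nat \<Rightarrow> real \<Rightarrow> real"
  assumes opt: "optimal g"
    and k_meas [measurable]: "\<And>n. k n \<in> borel_measurable M"
    and k_bound: "\<And>n x. \<bar>k n x\<bar> \<le> 1"
    and k_mono: "\<And>n. mono_on {a<..<b} (\<lambda>x. g x + k n x / real (Suc n))"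
    and k_lim: "\<And>x. (\<lambda>n. k n x) \<longlonglongrightarrow> k' x"
  shows "(LINT x|M. \<psi> (f x - g x) * k' x) \<le> 0"
proof -
  have [measurable]: "g \<in> borel_measurable M" and adm: "admissible g"
    and g_int: "integrable M (\<lambda>x. \<Psi> (g x))"
    using opt by (auto simp: optimal_def admissible_def)
  have [measurable]: "k' \<in> borel_measurable M"
    using k_lim k_meas by (rule borel_measurable_LIMSEQ_real)
  let ?u = "\<lambda>n x. f x - (g x + k n x / real (Suc n))"
  have small: "\<bar>k n x / real (Suc n)\<bar> \<le> 1" for n x
    unfolding abs_divide abs_of_nat by (subst divide_le_eq_1_pos) (use k_bound[of n x] in auto)
  \<comment> \<open>All perturbed residuals lie within distance \<open>1\<close> of \<open>f - g\<close>, and \<open>\<psi>\<close> is monotone.\<close>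
  define w where "w x = \<bar>\<psi> (f x - g x - 1)\<bar> + \<bar>\<psi> (f x - g x + 1)\<bar>" for x
  have shift_int: "integrable M (\<lambda>x. \<bar>\<psi> (f x - g x + c)\<bar>)" for c
    using integrable_\<Psi>_add[of "\<lambda>x. f x - g x" "\<lambda>_. c"] admissible_err_integrable[OF adm]
    by (intro Bochner_Integration.integrable_abs integrable_\<psi>) auto
  have w_int: "integrable M w"
    unfolding w_def using shift_int[of "- 1"] shift_int[of 1]
    by (intro Bochner_Integration.integrable_add) simp_all
  have w: "\<bar>\<psi> (?u n x) * k n x\<bar> \<le> w x" for n x
  proof -
    have "\<psi> (f x - g x - 1) \<le> \<psi> (f x - (g x + e)) \<and> \<psi> (f x - (g x + e)) \<le> \<psi> (f x - g x + 1)"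
      if "\<bar>e\<bar> \<le> 1" for e
      using that by (auto intro!: \<psi>_mono)
    note this[OF small[of n x]]
    then have "\<bar>\<psi> (?u n x)\<bar> \<le> w x" by (auto simp: w_def)
    moreover have "\<bar>\<psi> (?u n x)\<bar> * \<bar>k n x\<bar> \<le> \<bar>\<psi> (?u n x)\<bar> * 1"
      using k_bound by (intro mult_left_mono) auto
    ultimately show ?thesis by (simp add: abs_mult)
  qed
  have "(\<lambda>n. LINT x|M. \<psi> (?u n x) * k n x) \<longlonglongrightarrow> (LINT x|M. \<psi> (f x - g x) * k' x)"
  proof (rule integral_dominated_convergence[where w = w])
    show "AE x in M. (\<lambda>n. \<psi> (?u n x) * k n x) \<longlonglongrightarrow> \<psi> (f x - g x) * k' x"
    proof (rule AE_I2)
      fix x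
      have "(\<lambda>n. ?u n x) \<longlonglongrightarrow> f x - (g x + k' x * 0)"
        unfolding divide_inverse by (intro tendsto_intros k_lim LIMSEQ_inverse_real_of_nat)
      then have "(\<lambda>n. \<psi> (?u n x)) \<longlonglongrightarrow> \<psi> (f x - g x)"
        using \<psi>_continuous by (intro isCont_tendsto_compose[where g = \<psi>])
          (auto simp: continuous_on_eq_continuous_at)
      then show "(\<lambda>n. \<psi> (?u n x) * k n x) \<longlonglongrightarrow> \<psi> (f x - g x) * k' x"
        by (intro tendsto_intros k_lim)
    qed
  qed (use w_int w in auto)
  moreover have "(LINT x|M. \<psi> (?u n x) * k n x) \<le> 0" for n
  proof -
    have adm_n: "admissible (\<lambda>x. g x + k n x / real (Suc n))"
      unfolding admissible_def
      using k_mono[of n] integrable_\<Psi>_add[OF _ _ g_int integrable_\<Psi>_bounded[OF _ small[of n]]]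
      by simp
    have int_n: "integrable M (\<lambda>x. \<psi> (?u n x) * k n x)"
      by (rule Bochner_Integration.integrable_bound[OF w_int]) (use w in \<open>auto intro!: AE_I2 simp: w_def\<close>)
    have "(LINT x|M. \<psi> (?u n x) * k n x) / real (Suc n) = (LINT x|M. \<psi> (?u n x) * k n x / real (Suc n))"
      by simp
    also have "\<dots> \<le> (LINT x|M. \<Psi> (f x - g x) - \<Psi> (?u n x))"
    proof (rule integral_mono)
      show "\<psi> (?u n x) * k n x / real (Suc n) \<le> \<Psi> (f x - g x) - \<Psi> (?u n x)" for x
        using subgradient[of "?u n x" "f x - g x"] by simp
      show "integrable M (\<lambda>x. \<Psi> (f x - g x) - \<Psi> (?u n x))"
        using admissible_err_integrable[OF adm] admissible_err_integrable[OF adm_n]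
        by (rule Bochner_Integration.integrable_diff)
      show "integrable M (\<lambda>x. \<psi> (?u n x) * k n x / real (Suc n))"
        using int_n by (intro integrable_divide_zero)
    qed
    also have "\<dots> = err g - err (\<lambda>x. g x + k n x / real (Suc n))"
      unfolding err_def
      using admissible_err_integrable[OF adm] admissible_err_integrable[OF adm_n]
      by (rule Bochner_Integration.integral_diff)
    also have "\<dots> \<le> 0" using opt adm_n by (simp add: optimal_def)
    finally show ?thesis by (simp add: divide_le_0_iff)
  qed
  ultimately show ?thesis by (auto intro: LIMSEQ_le_const2)
qed

text \<open>
  Raising a monotone function by a constant on \<open>[t,\<infinity>)\<close> keeps it monotone.
\<close>

lemma optimal_tail_nonpos:
  assumes "optimal g"
  shows "(LINT x|M. \<psi> (f x - g x) * indicator {t..} x) \<le> 0"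
proof (rule optimal_variation[OF assms, where k = "\<lambda>_. indicator {t..}"])
  show "mono_on {a<..<b} (\<lambda>x. g x + indicator {t..} x / real (Suc n))" for n
  proof (rule mono_onI)
    fix x y assume xy: "x \<in> {a<..<b}" "y \<in> {a<..<b}" "x \<le> y"
    then have "g x \<le> g y"
      using assms by (auto simp: optimal_def admissible_def elim: mono_onD)
    moreover have "indicat_real {t..} x \<le> indicator {t..} y"
      using xy by (auto simp: indicator_def)
    ultimately show "g x + indicator {t..} x / real (Suc n) \<le> g y + indicator {t..} y / real (Suc n)"
      by (intro add_mono divide_right_mono) auto
  qed
  show "indicator {t..} \<in> borel_measurable M"
    by (intro measurable_restrict_space1 borel_measurable_indicator) auto
qed (auto simp: indicator_def)

lemma optimal_total_zero:
  assumes "optimal g"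
  shows "(LINT x|M. \<psi> (f x - g x)) = 0"
proof -
  have mono: "mono_on {a<..<b} (\<lambda>x. g x + c)" for c
    using assms by (auto simp: optimal_def admissible_def mono_on_def)
  have "(LINT x|M. \<psi> (f x - g x) * 1) \<le> 0"
    by (rule optimal_variation[OF assms, where k = "\<lambda>_ _. 1"]) (auto intro: mono)
  moreover have "(LINT x|M. \<psi> (f x - g x) * - 1) \<le> 0"
    by (rule optimal_variation[OF assms, where k = "\<lambda>_ _. - 1"]) (auto simp only: intro: mono, auto)
  ultimately show ?thesis by simp
qed

text \<open>
  Lowering \<open>g\<close> by \<open>min \<epsilon> (g - s)\<^sup>+\<close> keeps it monotone, and divided by \<open>\<epsilon>\<close> this perturbation tends to
  the indicator of \<open>{s < g}\<close>. So above any level that \<open>g\<close> crosses, the tail condition holds in the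
  reverse direction too.
\<close>

lemma optimal_superlevel_nonneg:
  assumes "optimal g"
  shows "0 \<le> (LINT x|M. \<psi> (f x - g x) * indicator {x. s < g x} x)"
proof -
  have [measurable]: "g \<in> borel_measurable M" and g_mono: "mono_on {a<..<b} g"
    using assms by (auto simp: optimal_def admissible_def)
  define k where "k n x = - min 1 (real (Suc n) * max 0 (g x - s))" for n x
  have "(LINT x|M. \<psi> (f x - g x) * - indicator {x. s < g x} x) \<le> 0"
  proof (rule optimal_variation[OF assms, where k = k])
    show "k n \<in> borel_measurable M" for n
      unfolding k_def by measurable
    show "\<bar>k n x\<bar> \<le> 1" for n x by (auto simp: k_def min_def)
    show "mono_on {a<..<b} (\<lambda>x. g x + k n x / real (Suc n))" for n
    proof (rule mono_onI)
      fix x y assume "x \<in> {a<..<b}" "y \<in> {a<..<b}" "x \<le> y"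
      then have "g x \<le> g y" using g_mono by (auto elim: mono_onD)
      moreover have "k n z / real (Suc n) = - min (1 / real (Suc n)) (max 0 (g z - s))" for z
        by (simp add: k_def min_def max_def field_simps)
      ultimately show "g x + k n x / real (Suc n) \<le> g y + k n y / real (Suc n)"
        by (simp add: min_def max_def split: if_splits)
    qed
    show "(\<lambda>n. k n x) \<longlonglongrightarrow> - indicator {x. s < g x} x" for x
    proof (cases "s < g x")
      case True
      obtain N :: nat where N: "1 < real N * (g x - s)"
        using True reals_Archimedean3[of "g x - s"] by auto
      have "k n x = - 1" if "n \<ge> N" for n
      proof -
        have "real N * (g x - s) \<le> real (Suc n) * (g x - s)"
          using that True by (intro mult_right_mono) auto
        then have "1 \<le> real (Suc n) * (g x - s)" using N by linarith
        then show ?thesis using True unfolding k_def by (simp only: min.absorb1 max.absorb2)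
      qed
      then show ?thesis using True
        by (intro tendsto_eventually) (auto simp: eventually_sequentially)
    qed (auto simp: k_def max_def)
  qed
  then show ?thesis by simp
qed

section \<open>Tail integrals of the residual\<close>

definition tail :: "(real \<Rightarrow> real) \<Rightarrow> real \<Rightarrow> real" where
  "tail p t = (LINT x|M. p x * indicator {t..} x)"

lemma indicator_measurable:
  "S \<in> sets lebesgue \<Longrightarrow> indicat_real S \<in> borel_measurable M"
  by (intro measurable_restrict_space1 borel_measurable_indicator)

lemma integrable_times_indicator:
  assumes "integrable M p" "S \<in> sets lebesgue"
  shows "integrable M (\<lambda>x. p x * indicat_real S x)"
proof (rule Bochner_Integration.integrable_bound[OF assms(1)])
  show "(\<lambda>x. p x * indicat_real S x) \<in> borel_measurable M"
    using assms by (intro borel_measurable_times borel_measurable_integrable indicator_measurable)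
qed (auto simp: indicator_def)

lemma tail_left_endpoint: "tail p a = integral\<^sup>L M p"
  unfolding tail_def by (rule Bochner_Integration.integral_cong) auto

lemma tail_right_endpoint: "tail p b = 0"
proof -
  have "AE x in lebesgue. x \<noteq> b"
    by (rule AE_I'[of "{b}"]) auto
  then have "AE x in M. p x * indicator {b..} x = 0"
    unfolding AE_lebesgue_on_iff by eventually_elim auto
  then show ?thesis
    unfolding tail_def by (rule integral_eq_zero_AE)
qed

lemma tail_diff:
  assumes "integrable M p" "u \<le> v"
  shows "tail p u - tail p v = (LINT x|M. p x * indicator {u..<v} x)"
proof -
  have "tail p u - tail p v = (LINT x|M. p x * indicator {u..} x - p x * indicator {v..} x)"
    unfolding tail_def
    by (intro Bochner_Integration.integral_diff[symmetric] integrable_times_indicator assms) auto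
  also have "\<dots> = (LINT x|M. p x * indicator {u..<v} x)"
    using \<open>u \<le> v\<close> by (intro Bochner_Integration.integral_cong) (auto simp: indicator_def)
  finally show ?thesis .
qed

lemma tail_continuous:
  assumes "integrable M p"
  shows "continuous_on {a..b} (tail p)"
proof -
  have p: "p integrable_on {a..b}"
    using assms by (rule integrable_on_lebesgue_on) auto
  have "tail p t = integral {t..b} p" if "t \<in> {a..b}" for t
  proof -
    have "tail p t = integral {a..b} (\<lambda>x. p x * indicator {t..} x)"
      unfolding tail_def by (intro lebesgue_integral_eq_integral integrable_times_indicator assms) auto
    also have "\<dots> = integral {a..b} (\<lambda>x. if x \<in> {t..} then p x else 0)"
      by (rule arg_cong[where f = "integral {a..b}"]) (auto simp: indicator_def)
    also have "\<dots> = integral ({t..} \<inter> {a..b}) p"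
      by (rule Henstock_Kurzweil_Integration.integral_restrict_Int)
    also have "{t..} \<inter> {a..b} = {t..b}" using that by auto
    finally show ?thesis .
  qed
  then show ?thesis
    using indefinite_integral_continuous_1'[OF p] continuous_on_cong by (metis (no_types, lifting))
qed

lemma tail_antimono:
  assumes "integrable M p" "u \<le> v" "AE x in M. x \<in> {u<..<v} \<longrightarrow> 0 \<le> p x"
  shows "tail p v \<le> tail p u"
proof -
  have "AE x in lebesgue. x \<noteq> u"
    by (rule AE_I'[of "{u}"]) auto
  then have "AE x in M. x \<noteq> u"
    unfolding AE_lebesgue_on_iff by eventually_elim auto
  with assms(3) have "AE x in M. 0 \<le> p x * indicator {u..<v} x"
    by eventually_elim (auto simp: indicator_def)
  then have "0 \<le> (LINT x|M. p x * indicator {u..<v} x)"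
    by (rule integral_nonneg_AE)
  then show ?thesis using tail_diff[OF assms(1,2)] by simp
qed

lemma tail_strict_antimono:
  assumes "integrable M p" "a \<le> u" "u < v" "v \<le> b" "AE x in M. x \<in> {u<..<v} \<longrightarrow> 0 < p x"
  shows "tail p v < tail p u"
proof -
  have "AE x in lebesgue. x \<noteq> u"
    by (rule AE_I'[of "{u}"]) auto
  then have "AE x in M. x \<noteq> u"
    unfolding AE_lebesgue_on_iff by eventually_elim auto
  with assms(5) have nn: "AE x in M. 0 \<le> p x * indicator {u..<v} x"
    by eventually_elim (auto simp: indicator_def)
  have "(LINT x|M. p x * indicator {u..<v} x) \<noteq> 0"
  proof
    assume "(LINT x|M. p x * indicator {u..<v} x) = 0"
    then have "AE x in M. p x * indicator {u..<v} x = 0"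
      by (subst (asm) integral_nonneg_eq_0_iff_AE[OF integrable_times_indicator[OF assms(1)] nn]) auto
    with assms(5) have "AE x in M. x \<notin> {u<..<v}"
      by eventually_elim (auto simp: indicator_def split: if_splits)
    then show False using AE_lebesgue_on_interval_witness[where a = a and b = b and u = u and v = v] assms(2-4) by blast
  qed
  moreover have "0 \<le> (LINT x|M. p x * indicator {u..<v} x)"
    using nn by (rule integral_nonneg_AE)
  ultimately show ?thesis using tail_diff[OF assms(1), of u v] assms(3) by simp
qed

lemma tail_uminus: "tail (\<lambda>x. - p x) t = - tail p t"
  by (simp add: tail_def)

lemma optimal_residual_integrable:
  "optimal g \<Longrightarrow> integrable M (\<lambda>x. \<psi> (f x - g x))"
  using admissible_err_integrable
  by (intro integrable_\<psi>) (auto simp: optimal_def admissible_def)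

text \<open>
  Complementary slackness: if \<open>g\<close> increased between \<open>x1\<close> and \<open>x2\<close>, then the superlevel set
  \<open>{g x1 < g}\<close> would be a half-line, up to null sets, that starts at some \<open>t\<close> between them, and the
  tail integral at \<open>t\<close> would be nonnegative.
\<close>

lemma optimal_constant_where_tail_negative:
  assumes opt: "optimal g" and x: "a < x1" "x1 \<le> x2" "x2 < b"
    and neg: "\<And>t. t \<in> {x1..x2} \<Longrightarrow> tail (\<lambda>x. \<psi> (f x - g x)) t < 0"
  shows "g x1 = g x2"
proof (rule ccontr)
  assume "g x1 \<noteq> g x2"
  have g_mono: "g y \<le> g z" if "a < y" "y \<le> z" "z < b" for y z
    using opt that by (auto simp: optimal_def admissible_def elim: mono_onD)
  then have less: "g x1 < g x2" using \<open>g x1 \<noteq> g x2\<close> x by force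
  define T where "T = {y. a < y \<and> y < b \<and> g x1 < g y}"
  have T_lower: "x1 \<le> y" if "y \<in> T" for y
    using that g_mono[of y x1] x by (force simp: T_def)
  have "x2 \<in> T" using less x by (auto simp: T_def)
  have bdd: "bdd_below T" using T_lower by (rule bdd_belowI)
  define t where "t = Inf T"
  have "x1 \<le> t" unfolding t_def using \<open>x2 \<in> T\<close> T_lower by (intro cInf_greatest) auto
  have "t \<le> x2" unfolding t_def using \<open>x2 \<in> T\<close> bdd by (rule cInf_lower)
  have level: "g x1 < g y \<longleftrightarrow> t \<le> y" if "a < y" "y < b" "y \<noteq> t" for y
  proof
    assume "g x1 < g y"
    then show "t \<le> y" unfolding t_def using that bdd by (intro cInf_lower) (auto simp: T_def)
  next
    assume "t \<le> y"
    then have "Inf T < y" using \<open>y \<noteq> t\<close> by (simp add: t_def)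
    then obtain z where "z \<in> T" "z < y"
      using cInf_lessD[of T y] \<open>x2 \<in> T\<close> by auto
    then show "g x1 < g y" using g_mono[of z y] that by (auto simp: T_def)
  qed
  have "AE y in lebesgue. y \<noteq> a \<and> y \<noteq> b \<and> y \<noteq> t"
    by (rule AE_I'[of "{a, b, t}"]) (auto intro!: null_sets_completionI countable_imp_null_set_lborel)
  then have ae: "AE y in M. \<psi> (f y - g y) * indicator {y. g x1 < g y} y = \<psi> (f y - g y) * indicator {t..} y"
    unfolding AE_lebesgue_on_iff by eventually_elim (auto simp: indicator_def level)
  have "0 \<le> (LINT y|M. \<psi> (f y - g y) * indicator {y. g x1 < g y} y)"
    using opt by (rule optimal_superlevel_nonneg)
  also have "\<dots> = tail (\<lambda>x. \<psi> (f x - g x)) t"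
    unfolding tail_def
  proof (rule integral_cong_AE[OF _ _ ae])
    have int: "integrable M (\<lambda>x. \<psi> (f x - g x))" using opt by (rule optimal_residual_integrable)
    show t_meas: "(\<lambda>y. \<psi> (f y - g y) * indicator {t..} y) \<in> borel_measurable M"
      by (rule borel_measurable_integrable[OF integrable_times_indicator[OF int]]) auto
    have [measurable]: "g \<in> borel_measurable M" using opt by (auto simp: optimal_def admissible_def)
    show "(\<lambda>y. \<psi> (f y - g y) * indicator {y. g x1 < g y} y) \<in> borel_measurable M"
      using borel_measurable_integrable[OF int] by measurable
  qed
  also have "\<dots> < 0" using neg \<open>x1 \<le> t\<close> \<open>t \<le> x2\<close> by auto
  finally show False by simp
qed

section \<open>Uniqueness\<close>

text \<open>
  The midpoint of two best approximants is a competitor, so the midpoint inequality for \<open>\<Psi>\<close> must be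
  an equality almost everywhere.
\<close>

lemma optimal_residuals_agree:
  assumes "optimal g1" "optimal g2"
  shows "AE x in M. \<psi> (f x - g1 x) = \<psi> (f x - g2 x)"
proof -
  define m where "m x = (g1 x + g2 x) / 2" for x
  have adm: "admissible g1" "admissible g2" using assms by (auto simp: optimal_def)
  have [measurable]: "g1 \<in> borel_measurable M" "g2 \<in> borel_measurable M"
    using adm by (auto simp: admissible_def)
  have half: "integrable M (\<lambda>x. \<Psi> (g x / 2))" if "admissible g" for g
  proof (rule Bochner_Integration.integrable_bound)
    show "integrable M (\<lambda>x. \<Psi> (g x))" using that by (simp add: admissible_def)
    have "g \<in> borel_measurable M" using that by (simp add: admissible_def)
    then show "(\<lambda>x. \<Psi> (g x / 2)) \<in> borel_measurable M" by measurable
    show "AE x in M. norm (\<Psi> (g x / 2)) \<le> norm (\<Psi> (g x))"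
      by (intro AE_I2) (simp add: \<Psi>_nonneg \<Psi>_mono_abs)
  qed
  have m_adm: "admissible m"
    unfolding admissible_def
  proof (intro conjI)
    show "mono_on {a<..<b} m"
      using adm by (auto simp: admissible_def m_def mono_on_def intro!: divide_right_mono add_mono)
    show "m \<in> borel_measurable M"
      unfolding m_def by measurable
    show "integrable M (\<lambda>x. \<Psi> (m x))"
      unfolding m_def add_divide_distrib by (intro integrable_\<Psi>_add half adm) measurable
  qed
  note int = admissible_err_integrable[OF adm(1)] admissible_err_integrable[OF adm(2)]
    admissible_err_integrable[OF m_adm]
  define D where "D x = (\<Psi> (f x - g1 x) + \<Psi> (f x - g2 x)) / 2 - \<Psi> (f x - m x)" for x
  have res: "((f x - g1 x) + (f x - g2 x)) / 2 = f x - m x" for x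
    by (simp add: m_def field_simps)
  have D_nonneg: "0 \<le> D x" for x
    using \<Psi>_midpoint[of "f x - g1 x" "f x - g2 x", unfolded res] by (simp add: D_def)
  have D_int: "integrable M D" unfolding D_def using int by simp
  have "integral\<^sup>L M D = (err g1 + err g2) / 2 - err m"
    unfolding D_def err_def using int by simp
  also have "\<dots> \<le> 0" using assms m_adm adm by (force simp: optimal_def)
  finally have "integral\<^sup>L M D \<le> 0" .
  moreover have "0 \<le> integral\<^sup>L M D" using D_nonneg by (intro Bochner_Integration.integral_nonneg)
  ultimately have "integral\<^sup>L M D = 0" by simp
  then have "AE x in M. D x = 0"
    by (subst (asm) integral_nonneg_eq_0_iff_AE[OF D_int]) (simp_all add: D_nonneg)
  then show ?thesis
  proof eventually_elim
    case (elim x)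
    show ?case
      using \<psi>_eq_if_midpoint_eq[of "f x - g1 x" "f x - g2 x", unfolded res] elim
      by (simp add: D_def)
  qed
qed

text \<open>
  The heart of the uniqueness proof. Let \<open>H\<close> be the tail integral of
  \<open>p = \<psi>(f - g1) = \<psi>(f - g2)\<close>. Since \<open>\<psi>\<close> vanishes only at \<open>0\<close>, the value \<open>f\<close> lies outside
  \<open>[g1,g2]\<close> almost everywhere on the set \<open>{g1 < g2}\<close>.

  Near \<open>x0\<close> the two functions are separated by a fixed gap, so \<open>f\<close> stays on one side of it and \<open>p\<close> has
  a strict sign there. As \<open>H \<le> 0\<close>, this gives \<open>H x0 < 0\<close>. On the component \<open>(\<alpha>,\<beta>)\<close> of \<open>{H < 0}\<close> around
  \<open>x0\<close> both approximants are constant, so the gap argument applies to the whole component, and \<open>p\<close> has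
  one sign on \<open>(\<alpha>,\<beta>)\<close>. Then \<open>H\<close> is monotone on \<open>[\<alpha>,\<beta>]\<close> and zero at both ends, which contradicts
  \<open>H x0 < 0\<close>.
\<close>

lemma optimal_not_less:
  assumes opt: "optimal g1" "optimal g2"
    and ac: "\<And>x. x \<in> {a<..<b} \<Longrightarrow> approx_continuous_at a b f x"
    and x0: "a < x0" "x0 < b" and cont: "isCont g1 x0" "isCont g2 x0" and less: "g1 x0 < g2 x0"
  shows False
proof -
  define p where "p x = \<psi> (f x - g1 x)" for x
  have p_int: "integrable M p" unfolding p_def using opt(1) by (rule optimal_residual_integrable)
  have p_eq: "AE x in M. p x = \<psi> (f x - g2 x)"
    unfolding p_def using opt by (rule optimal_residuals_agree)
  have tail2: "tail (\<lambda>x. \<psi> (f x - g2 x)) t = tail p t" for t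
    unfolding tail_def
  proof (rule integral_cong_AE)
    show "AE x in M. \<psi> (f x - g2 x) * indicator {t..} x = p x * indicator {t..} x"
      using p_eq by eventually_elim simp
  qed (intro borel_measurable_integrable integrable_times_indicator p_int
        optimal_residual_integrable opt, simp)+
  have tail_nonpos: "tail p t \<le> 0" for t
    unfolding p_def tail_def using opt(1) by (rule optimal_tail_nonpos)
  have tail_ends: "tail p a = 0" "tail p b = 0"
    using optimal_total_zero[OF opt(1)] by (simp_all add: tail_left_endpoint tail_right_endpoint p_def[abs_def])
  have gap: "AE x in M. g1 x < g2 x \<longrightarrow> (f x < g1 x \<and> p x < 0) \<or> (g2 x < f x \<and> 0 < p x)"
    using p_eq
  proof eventually_elim
    case (elim x)
    show ?case
    proof
      assume "g1 x < g2 x"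
      show "(f x < g1 x \<and> p x < 0) \<or> (g2 x < f x \<and> 0 < p x)"
      proof (cases "f x" "g1 x" rule: linorder_cases)
        case less
        then show ?thesis using \<psi>_neg[of "f x - g1 x"] by (simp add: p_def)
      next
        case equal
        then have "p x = 0" by (simp add: p_def \<psi>_eq_0_iff)
        then have "f x = g2 x" using elim by (simp add: \<psi>_eq_0_iff)
        then show ?thesis using equal \<open>g1 x < g2 x\<close> by simp
      next
        case greater
        then have "0 < p x" using \<psi>_pos[of "f x - g1 x"] by (simp add: p_def)
        moreover have "g2 x < f x"
        proof (rule ccontr)
          assume "\<not> g2 x < f x"
          then have "\<psi> (f x - g2 x) \<le> \<psi> 0" by (intro \<psi>_mono) simp
          then show False using \<open>0 < p x\<close> elim \<psi>_eq_0_iff[of 0] by simp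
        qed
        ultimately show ?thesis by simp
      qed
    qed
  qed
  \<comment> \<open>Near \<open>x0\<close> the levels \<open>\<gamma> < \<gamma>'\<close> separate the two approximants.\<close>
  obtain \<gamma> where \<gamma>: "g1 x0 < \<gamma>" "\<gamma> < g2 x0" using less dense by blast
  obtain \<gamma>' where \<gamma>': "\<gamma> < \<gamma>'" "\<gamma>' < g2 x0" using \<gamma> dense by blast
  have "\<forall>\<^sub>F x in at x0. g1 x < \<gamma>" "\<forall>\<^sub>F x in at x0. \<gamma>' < g2 x"
    using cont \<gamma> \<gamma>' by (auto simp: isCont_def intro: order_tendstoD)
  then have "\<forall>\<^sub>F x in at x0. g1 x < \<gamma> \<and> \<gamma>' < g2 x" by (rule eventually_conj)
  then obtain e where "e > 0" and e: "\<And>x. x \<noteq> x0 \<Longrightarrow> dist x x0 < e \<Longrightarrow> g1 x < \<gamma> \<and> \<gamma>' < g2 x"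
    unfolding eventually_at by auto
  define l r where "l = max a (x0 - e)" and "r = min b (x0 + e)"
  have lr: "a \<le> l" "l < x0" "x0 < r" "r \<le> b" using \<open>e > 0\<close> x0 by (auto simp: l_def r_def)
  have near: "g1 x < \<gamma> \<and> \<gamma>' < g2 x" if "x \<in> {l<..<r}" for x
    using that e[of x] \<gamma> \<gamma>' by (cases "x = x0") (auto simp: l_def r_def dist_real_def)
  have "(\<forall>x\<in>{l<..<r}. f x \<le> \<gamma>) \<or> (\<forall>x\<in>{l<..<r}. \<gamma>' \<le> f x)"
  proof (rule approx_continuous_ae_gap_imp_one_sided[OF f_measurable])
    show "AE x in M. x \<in> {l<..<r} \<longrightarrow> f x \<le> \<gamma> \<or> \<gamma>' \<le> f x"
      using gap by eventually_elim (use near \<gamma>' in force)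
  qed (use lr \<gamma>' ac in auto)
  then have tail_x0: "tail p x0 < 0"
  proof
    assume side: "\<forall>x\<in>{l<..<r}. f x \<le> \<gamma>"
    have "AE x in M. x \<in> {x0<..<r} \<longrightarrow> 0 < - p x"
      using gap
    proof eventually_elim
      case (elim x)
      show ?case
      proof
        assume "x \<in> {x0<..<r}"
        then have "x \<in> {l<..<r}" using lr by simp
        then have "f x \<le> \<gamma>" "g1 x < \<gamma>" "\<gamma>' < g2 x" using side near by auto
        then show "0 < - p x" using elim \<gamma>'(1) by auto
      qed
    qed
    then have "tail (\<lambda>x. - p x) r < tail (\<lambda>x. - p x) x0"
      using p_int lr x0 by (intro tail_strict_antimono) auto
    then show ?thesis using tail_nonpos[of r] by (simp add: tail_uminus)
  next
    assume side: "\<forall>x\<in>{l<..<r}. \<gamma>' \<le> f x"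
    have "AE x in M. x \<in> {l<..<x0} \<longrightarrow> 0 < p x"
      using gap by eventually_elim (use side near \<gamma>' lr in force)
    then have "tail p x0 < tail p l"
      using p_int lr x0 by (intro tail_strict_antimono) auto
    then show ?thesis using tail_nonpos[of l] by simp
  qed
  \<comment> \<open>The zeros of the tail integral nearest to \<open>x0\<close> bound the component of \<open>{H < 0}\<close>.\<close>
  define Z where "Z = {t \<in> {a..b}. tail p t = 0}"
  have "closed Z"
    unfolding Z_def using continuous_closed_preimage_constant[OF tail_continuous[OF p_int]] by simp
  then have comp: "compact (Z \<inter> {a..x0})" "compact (Z \<inter> {x0..b})" by auto
  have "a \<in> Z \<inter> {a..x0}" "b \<in> Z \<inter> {x0..b}" using tail_ends x0 by (auto simp: Z_def)
  then obtain \<alpha> \<beta> where \<alpha>: "\<alpha> \<in> Z \<inter> {a..x0}" "\<And>t. t \<in> Z \<inter> {a..x0} \<Longrightarrow> t \<le> \<alpha>"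
    and \<beta>: "\<beta> \<in> Z \<inter> {x0..b}" "\<And>t. t \<in> Z \<inter> {x0..b} \<Longrightarrow> \<beta> \<le> t"
    using compact_attains_sup[OF comp(1)] compact_attains_inf[OF comp(2)] by blast
  have ends: "a \<le> \<alpha>" "\<alpha> < x0" "x0 < \<beta>" "\<beta> \<le> b" "tail p \<alpha> = 0" "tail p \<beta> = 0"
    using \<alpha>(1) \<beta>(1) tail_x0 by (auto simp: Z_def less_le)
  have neg: "tail p t < 0" if "t \<in> {\<alpha><..<\<beta>}" for t
  proof -
    have "t \<notin> Z" using that \<alpha>(2)[of t] \<beta>(2)[of t] ends by force
    then show ?thesis using that ends tail_nonpos[of t] by (auto simp: Z_def)
  qed
  have const: "g x = g x0" if g: "optimal g" "\<And>t. tail (\<lambda>x. \<psi> (f x - g x)) t = tail p t"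
    and x: "x \<in> {\<alpha><..<\<beta>}" for g x
  proof (cases "x \<le> x0")
    case True
    then show ?thesis
      using optimal_constant_where_tail_negative[OF g(1), of x x0] neg x x0 ends g(2) by auto
  next
    case False
    then show ?thesis
      using optimal_constant_where_tail_negative[OF g(1), of x0 x] neg x x0 ends g(2) by auto
  qed
  have g1_const: "g1 x = g1 x0" and g2_const: "g2 x = g2 x0" if "x \<in> {\<alpha><..<\<beta>}" for x
    using const[OF opt(1) _ that] const[OF opt(2) tail2 that] by (simp_all add: p_def[abs_def])
  have gap': "AE x in M. x \<in> {\<alpha><..<\<beta>} \<longrightarrow>
      (f x < g1 x0 \<and> p x < 0) \<or> (g2 x0 < f x \<and> 0 < p x)"
    using gap
  proof eventually_elim
    case (elim x)
    show ?case
    proof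
      assume x: "x \<in> {\<alpha><..<\<beta>}"
      show "(f x < g1 x0 \<and> p x < 0) \<or> (g2 x0 < f x \<and> 0 < p x)"
        using elim less unfolding g1_const[OF x] g2_const[OF x] by blast
    qed
  qed
  have "(\<forall>x\<in>{\<alpha><..<\<beta>}. f x \<le> g1 x0) \<or> (\<forall>x\<in>{\<alpha><..<\<beta>}. g2 x0 \<le> f x)"
  proof (rule approx_continuous_ae_gap_imp_one_sided[OF f_measurable _ _ _ _ less])
    show "AE x in M. x \<in> {\<alpha><..<\<beta>} \<longrightarrow> f x \<le> g1 x0 \<or> g2 x0 \<le> f x"
      using gap' by eventually_elim auto
  qed (use ends ac in auto)
  then show False
  proof
    assume side: "\<forall>x\<in>{\<alpha><..<\<beta>}. f x \<le> g1 x0"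
    have "AE x in M. x \<in> {\<alpha><..<x0} \<longrightarrow> 0 \<le> - p x"
      using gap' by eventually_elim (use side less ends in force)
    then have "tail (\<lambda>x. - p x) x0 \<le> tail (\<lambda>x. - p x) \<alpha>"
      using p_int ends by (intro tail_antimono) auto
    then show False using tail_x0 ends by (simp add: tail_uminus)
  next
    assume side: "\<forall>x\<in>{\<alpha><..<\<beta>}. g2 x0 \<le> f x"
    have "AE x in M. x \<in> {x0<..<\<beta>} \<longrightarrow> 0 \<le> p x"
      using gap'
    proof eventually_elim
      case (elim x)
      show ?case
      proof
        assume "x \<in> {x0<..<\<beta>}"
        then have "x \<in> {\<alpha><..<\<beta>}" using ends by simp
        moreover from this have "g2 x0 \<le> f x" using side by blast
        ultimately show "0 \<le> p x" using elim less by auto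
      qed
    qed
    then have "tail p \<beta> \<le> tail p x0"
      using p_int ends by (intro tail_antimono) auto
    then show False using tail_x0 ends by simp
  qed
qed

lemma mono_on_AE_isCont:
  assumes "mono_on {a<..<b} (g :: real \<Rightarrow> real)"
  shows "AE x in M. x \<in> {a<..<b} \<and> isCont g x"
proof -
  let ?C = "{x \<in> {a<..<b}. \<not> continuous (at x within {a<..<b}) g}"
  have "countable (?C \<union> {a, b})" using mono_on_ctble_discont[OF assms] by simp
  then have "?C \<union> {a, b} \<in> null_sets lebesgue"
    by (intro null_sets_completionI countable_imp_null_set_lborel)
  then have "AE x in lebesgue. x \<notin> ?C \<union> {a, b}" by (rule AE_not_in)
  then show ?thesis
    unfolding AE_lebesgue_on_iff
    by eventually_elim (auto simp: at_within_open[of _ "{a<..<b}"])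
qed

text \<open>
  Two monotone functions that are not equal almost everywhere differ at a common point of continuity.
\<close>

theorem optimal_unique:
  assumes opt: "optimal g1" "optimal g2"
    and ac: "\<And>x. x \<in> {a<..<b} \<Longrightarrow> approx_continuous_at a b f x"
  shows "AE x in M. g1 x = g2 x"
proof -
  have "AE x in M. x \<in> {a<..<b} \<and> isCont g1 x" "AE x in M. x \<in> {a<..<b} \<and> isCont g2 x"
    using opt by (intro mono_on_AE_isCont; simp add: optimal_def admissible_def)+
  then show ?thesis
  proof eventually_elim
    case (elim x)
    then show ?case
      using optimal_not_less[OF opt ac, of x] optimal_not_less[OF opt(2,1) ac, of x]
      by (cases "g1 x" "g2 x" rule: linorder_cases) auto
  qed
qed

end

section \<open>Existence\<close>

text \<open>
  Helly's selection theorem for sequences that are bounded at each point, but not uniformly: near the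
  end points a sequence of monotone functions of bounded error may blow up. A subsequence
  converges at all rational points, and the limit function \<open>g\<close> is the supremum of the rational limits
  to the left. Monotonicity squeezes the sequence at every point where \<open>g\<close> is continuous.
\<close>

lemma Helly_selection_on_open_interval:
  fixes h :: "nat \<Rightarrow> real \<Rightarrow> real"
  assumes mono: "\<And>n. mono_on {a<..<b} (h n)"
    and bound: "\<And>n x. x \<in> {a<..<b} \<Longrightarrow> \<bar>h n x\<bar> \<le> B x"
  obtains s g where "strict_mono (s :: nat \<Rightarrow> nat)" "mono_on {a<..<b} g"
    "\<And>x. x \<in> {a<..<b} \<Longrightarrow> isCont g x \<Longrightarrow> (\<lambda>n. h (s n) x) \<longlonglongrightarrow> g x"
proof -
  have hm: "h n x \<le> h n y" if "a < x" "x \<le> y" "y < b" for n x y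
    using mono[of n] that by (auto elim: mono_onD)
  define S where "S = \<rat> \<inter> {a<..<b}"
  have "countable S" unfolding S_def by (intro countable_Int1 countable_rat)
  have B1: "0 < B x + 1" if "x \<in> {a<..<b}" for x using bound[OF that, of 0] by linarith
  \<comment> \<open>Dividing by \<open>B x + 1\<close> makes the bound uniform.\<close>
  have "norm (h n x / (B x + 1)) \<le> 1" if "x \<in> S" for n x
  proof -
    have "x \<in> {a<..<b}" using that by (simp add: S_def)
    then show ?thesis using bound[of x n] B1[of x] by simp
  qed
  then obtain s where s: "strict_mono s"
    and ex: "\<And>x. x \<in> S \<Longrightarrow> \<exists>l. (\<lambda>n. h (s n) x / (B x + 1)) \<longlonglongrightarrow> l"
    using function_convergent_subsequence[OF \<open>countable S\<close>, of "\<lambda>n x. h n x / (B x + 1)" 1] by blast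
  have "\<exists>l. (\<lambda>n. h (s n) x) \<longlonglongrightarrow> l" if x: "x \<in> S" for x
  proof -
    obtain l where "(\<lambda>n. h (s n) x / (B x + 1)) \<longlonglongrightarrow> l" using ex[OF x] by blast
    then have "(\<lambda>n. h (s n) x / (B x + 1) * (B x + 1)) \<longlonglongrightarrow> l * (B x + 1)"
      by (intro tendsto_intros)
    moreover have "B x + 1 \<noteq> 0" using B1[of x] x by (auto simp: S_def)
    ultimately show ?thesis by auto
  qed
  then obtain l where l: "\<And>x. x \<in> S \<Longrightarrow> (\<lambda>n. h (s n) x) \<longlonglongrightarrow> l x" by metis
  have l_mono: "l x \<le> l y" if "x \<in> S" "y \<in> S" "x \<le> y" for x y
    by (rule LIMSEQ_le[OF l[OF that(1)] l[OF that(2)]]) (use that hm in \<open>auto simp: S_def\<close>)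
  have rat: "\<exists>q\<in>S. x < q \<and> q < y" if "a \<le> x" "x < y" "y \<le> b" for x y
    using Rats_dense_in_real[of x y] that by (auto simp: S_def)
  define L where "L x = l ` {q \<in> S. q < x}" for x
  have L_ne: "L x \<noteq> {}" if "x \<in> {a<..<b}" for x
    using rat[of a x] that by (auto simp: L_def)
  have L_bdd: "bdd_above (L x)" if x: "x \<in> {a<..<b}" for x
  proof -
    obtain r where r: "r \<in> S" "x < r" using rat[of x b] x by auto
    show ?thesis
      by (rule bdd_aboveI[of _ "l r"]) (use r l_mono in \<open>auto simp: L_def\<close>)
  qed
  define g where "g x = Sup (L x)" for x
  have "mono_on {a<..<b} g"
    unfolding g_def by (intro mono_onI cSup_subset_mono L_ne L_bdd) (auto simp: L_def)
  moreover have "(\<lambda>n. h (s n) x) \<longlonglongrightarrow> g x" if x: "x \<in> {a<..<b}" and cont: "isCont g x" for x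
  proof (rule order_tendstoI)
    fix y assume "y < g x"
    then obtain q where q: "q \<in> S" "q < x" "y < l q"
      using less_cSup_iff[OF L_ne[OF x] L_bdd[OF x]] by (auto simp: g_def L_def)
    have "\<forall>\<^sub>F n in sequentially. y < h (s n) q" using l[OF q(1)] q(3) by (rule order_tendstoD)
    then show "\<forall>\<^sub>F n in sequentially. y < h (s n) x"
      by eventually_elim (use hm[of q x] q x in \<open>auto simp: S_def intro: less_le_trans\<close>)
  next
    fix y assume "g x < y"
    then have "\<forall>\<^sub>F z in at x. g z < y" using cont by (auto simp: isCont_def intro: order_tendstoD)
    then obtain e where "e > 0" and e: "\<And>z. z \<noteq> x \<Longrightarrow> dist z x < e \<Longrightarrow> g z < y"
      unfolding eventually_at by auto
    define z where "z = min (x + e / 2) ((x + b) / 2)"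
    have z: "x < z" "z < b" "dist z x < e"
      using x \<open>e > 0\<close> by (auto simp: z_def dist_real_def min_def)
    obtain r where r: "r \<in> S" "x < r" "r < z" using rat[of x z] x z by auto
    have "bdd_above (L z)" using L_bdd[of z] x z by auto
    then have "l r \<le> g z"
      unfolding g_def using r by (intro cSup_upper) (auto simp: L_def)
    also have "g z < y" using e z by auto
    finally have "\<forall>\<^sub>F n in sequentially. h (s n) r < y" using l[OF r(1)] by (intro order_tendstoD)
    then show "\<forall>\<^sub>F n in sequentially. h (s n) x < y"
      by eventually_elim (use hm[of x r] r x in \<open>auto simp: S_def intro: le_less_trans\<close>)
  qed
  ultimately show thesis using s that by blast
qed

lemma mono_on_extension_borel_measurable:
  assumes "mono_on {a<..<b} (g :: real \<Rightarrow> real)"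
  shows "(\<lambda>x. if x \<in> {a<..<b} then g x else 0) \<in> borel_measurable (lebesgue_on S)"
proof -
  have "(\<lambda>x. if x \<in> {a<..<b} then g x else 0) \<in> borel_measurable borel"
    by (subst measurable_If_restrict_space_iff)
      (use borel_measurable_mono_on_fnc[OF assms] in \<open>auto simp: greaterThanLessThan_def Int_def\<close>)
  then show ?thesis
    by (intro measurable_restrict_space1 measurable_completion) simp
qed

context monotone_approximation
begin

text \<open>
  A monotone function that is large in absolute value at \<open>x\<close> is at least as large on all of \<open>(x,b)\<close> or
  on all of \<open>(a,x)\<close>, so its integral controls its values at interior points.
\<close>

lemma admissible_pointwise_bound:
  assumes adm: "admissible g" and x: "x \<in> {a<..<b}"
  shows "\<Psi> (g x) * min (x - a) (b - x) \<le> (LINT t|M. \<Psi> (g t))"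
proof -
  have g_mono: "g y \<le> g z" if "a < y" "y \<le> z" "z < b" for y z
    using adm that by (auto simp: admissible_def elim: mono_onD)
  have half: "\<Psi> (g x) * (v - u) \<le> (LINT t|M. \<Psi> (g t))"
    if uv: "a \<le> u" "u \<le> v" "v \<le> b" and le: "\<And>t. t \<in> {u<..<v} \<Longrightarrow> \<bar>g x\<bar> \<le> \<bar>g t\<bar>" for u v
  proof -
    have "\<Psi> (g x) * (v - u) = (LINT t|M. \<Psi> (g x) * indicator {u<..<v} t)"
    proof -
      have "measure M {u<..<v} = v - u"
        using uv by (subst measure_restrict_space) auto
      moreover have "{u<..<v} \<inter> {a..b} = {u<..<v}" using uv by auto
      ultimately show ?thesis by simp
    qed
    also have "\<dots> \<le> (LINT t|M. \<Psi> (g t))"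
    proof (rule integral_mono)
      show "integrable M (\<lambda>t. \<Psi> (g x) * indicator {u<..<v} t)"
        by (rule integrable_times_indicator) auto
      show "integrable M (\<lambda>t. \<Psi> (g t))" using adm by (simp add: admissible_def)
      show "\<Psi> (g x) * indicator {u<..<v} t \<le> \<Psi> (g t)" for t
        using le[of t] by (auto simp: indicator_def \<Psi>_nonneg intro: \<Psi>_mono_abs)
    qed
    finally show ?thesis .
  qed
  show ?thesis
  proof (cases "0 \<le> g x")
    case True
    have "\<bar>g x\<bar> \<le> \<bar>g t\<bar>" if "t \<in> {x<..<b}" for t using g_mono[of x t] x that True by auto
    then have "\<Psi> (g x) * (b - x) \<le> (LINT t|M. \<Psi> (g t))" using half[of x b] x by auto
    moreover have "\<Psi> (g x) * min (x - a) (b - x) \<le> \<Psi> (g x) * (b - x)"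
      by (intro mult_left_mono \<Psi>_nonneg) simp
    ultimately show ?thesis by linarith
  next
    case False
    have "\<bar>g x\<bar> \<le> \<bar>g t\<bar>" if "t \<in> {a<..<x}" for t using g_mono[of t x] x that False by auto
    then have "\<Psi> (g x) * (x - a) \<le> (LINT t|M. \<Psi> (g t))" using half[of a x] x by auto
    moreover have "\<Psi> (g x) * min (x - a) (b - x) \<le> \<Psi> (g x) * (x - a)"
      by (intro mult_left_mono \<Psi>_nonneg) simp
    ultimately show ?thesis by linarith
  qed
qed

lemma admissible_modular_le:
  assumes "admissible g"
  shows "(LINT x|M. \<Psi> (g x)) \<le> K / 2 * ((LINT x|M. \<Psi> (f x)) + err g)"
proof -
  have "(LINT x|M. \<Psi> (g x)) \<le> (LINT x|M. K / 2 * (\<Psi> (f x) + \<Psi> (f x - g x)))"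
  proof (rule integral_mono)
    show "integrable M (\<lambda>x. \<Psi> (g x))" using assms by (simp add: admissible_def)
    show "integrable M (\<lambda>x. K / 2 * (\<Psi> (f x) + \<Psi> (f x - g x)))"
      using f_integrable admissible_err_integrable[OF assms] by simp
    show "\<Psi> (g x) \<le> K / 2 * (\<Psi> (f x) + \<Psi> (f x - g x))" for x
      using \<Psi>_add_le[of "f x" "- (f x - g x)"] unfolding \<Psi>_even by simp
  qed
  also have "\<dots> = K / 2 * ((LINT x|M. \<Psi> (f x)) + err g)"
    using f_integrable admissible_err_integrable[OF assms] by (simp add: err_def)
  finally show ?thesis .
qed

text \<open>
  A minimizing sequence has bounded modulars, hence is bounded at each interior point. Helly's theorem
  and Fatou's lemma provide a minimizer.
\<close>

theorem optimal_exists: "\<exists>g. optimal g"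
proof -
  have zero: "admissible (\<lambda>_. 0)" by (auto simp: admissible_def \<Psi>_0 mono_on_def)
  define m where "m = Inf (err ` Collect admissible)"
  have bdd: "bdd_below (err ` Collect admissible)"
    using err_nonneg by (intro bdd_belowI[of _ 0]) auto
  have m_le: "m \<le> err g" if "admissible g" for g
    unfolding m_def using bdd that by (intro cInf_lower) auto
  have "\<exists>g. admissible g \<and> err g < m + inverse (real (Suc n))" for n
    using cInf_lessD[of "err ` Collect admissible" "m + inverse (real (Suc n))"] zero
    by (auto simp: m_def)
  then obtain h where h: "\<And>n. admissible (h n)" and err_h: "\<And>n. err (h n) < m + inverse (real (Suc n))"
    by metis
  define C where "C = K / 2 * ((LINT x|M. \<Psi> (f x)) + (m + 1))"
  have h_bound: "\<bar>h n x\<bar> \<le> 1 + C / (\<psi> 1 * min (x - a) (b - x))" if x: "x \<in> {a<..<b}" for n x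
  proof -
    let ?d = "min (x - a) (b - x)"
    have pos: "0 < ?d" "0 < \<psi> 1" using x \<psi>_pos[of 1] by auto
    have "inverse (real (Suc n)) \<le> 1" by (simp add: inverse_le_1_iff)
    then have "err (h n) \<le> m + 1" using err_h[of n] by linarith
    then have "K / 2 * ((LINT x|M. \<Psi> (f x)) + err (h n)) \<le> C"
      unfolding C_def using K_pos by (intro mult_left_mono) auto
    then have "\<Psi> (h n x) * ?d \<le> C"
      using admissible_pointwise_bound[OF h x, of n] admissible_modular_le[OF h, of n] by linarith
    moreover have "\<psi> 1 * (\<bar>h n x\<bar> - 1) * ?d \<le> \<Psi> (h n x) * ?d"
      using \<Psi>_linear_growth pos by (intro mult_right_mono) auto
    ultimately have "(\<bar>h n x\<bar> - 1) * (\<psi> 1 * ?d) \<le> C" by (simp only: mult_ac)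
    then have "\<bar>h n x\<bar> - 1 \<le> C / (\<psi> 1 * ?d)" using pos by (simp add: pos_le_divide_eq)
    then show ?thesis by linarith
  qed
  obtain s g0 where s: "strict_mono (s :: nat \<Rightarrow> nat)" and g0_mono: "mono_on {a<..<b} g0"
    and lim: "\<And>x. x \<in> {a<..<b} \<Longrightarrow> isCont g0 x \<Longrightarrow> (\<lambda>n. h (s n) x) \<longlonglongrightarrow> g0 x"
    by (rule Helly_selection_on_open_interval[of a b h "\<lambda>x. 1 + C / (\<psi> 1 * min (x - a) (b - x))"])
      (use h h_bound in \<open>auto simp: admissible_def\<close>)
  define g where "g x = (if x \<in> {a<..<b} then g0 x else 0)" for x
  have g_mono: "mono_on {a<..<b} g" using g0_mono by (auto simp: g_def mono_on_def)
  have g_meas [measurable]: "g \<in> borel_measurable M"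
    unfolding g_def[abs_def] using g0_mono by (rule mono_on_extension_borel_measurable)
  have [measurable]: "h n \<in> borel_measurable M" for n using h by (simp add: admissible_def)
  have "AE x in M. ennreal (\<Psi> (f x - g x)) = liminf (\<lambda>n. ennreal (\<Psi> (f x - h (s n) x)))"
    using mono_on_AE_isCont[OF g0_mono]
  proof eventually_elim
    case (elim x)
    then have "(\<lambda>n. h (s n) x) \<longlonglongrightarrow> g x" using lim by (simp add: g_def)
    then have "(\<lambda>n. \<Psi> (f x - h (s n) x)) \<longlonglongrightarrow> \<Psi> (f x - g x)"
      using \<Psi>_continuous by (intro isCont_tendsto_compose[where g = \<Psi>] tendsto_intros)
        (auto simp: continuous_on_eq_continuous_at)
    then have "(\<lambda>n. ennreal (\<Psi> (f x - h (s n) x))) \<longlonglongrightarrow> ennreal (\<Psi> (f x - g x))"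
      by (rule tendsto_ennrealI)
    then show ?case by (intro lim_imp_Liminf[symmetric]) auto
  qed
  then have "(\<integral>\<^sup>+ x. ennreal (\<Psi> (f x - g x)) \<partial>M) = (\<integral>\<^sup>+ x. liminf (\<lambda>n. ennreal (\<Psi> (f x - h (s n) x))) \<partial>M)"
    by (rule nn_integral_cong_AE)
  also have "\<dots> \<le> liminf (\<lambda>n. \<integral>\<^sup>+ x. ennreal (\<Psi> (f x - h (s n) x)) \<partial>M)"
    by (rule nn_integral_liminf) measurable
  also have "(\<lambda>n. \<integral>\<^sup>+ x. ennreal (\<Psi> (f x - h (s n) x)) \<partial>M) = (\<lambda>n. ennreal (err (h (s n))))"
    unfolding err_def using admissible_err_integrable[OF h]
    by (intro ext nn_integral_eq_integral) (auto simp: \<Psi>_nonneg)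
  also have "liminf \<dots> = ennreal m"
  proof (intro lim_imp_Liminf tendsto_ennrealI)
    have "(\<lambda>n. err (h n)) \<longlonglongrightarrow> m"
    proof (rule tendsto_sandwich[of "\<lambda>_. m"])
      show "(\<lambda>n. m + inverse (real (Suc n))) \<longlonglongrightarrow> m"
        using tendsto_add[OF tendsto_const LIMSEQ_inverse_real_of_nat, of m] by simp
    qed (use m_le[OF h] err_h in \<open>auto intro: less_imp_le always_eventually\<close>)
    then show "(\<lambda>n. err (h (s n))) \<longlonglongrightarrow> m"
      using LIMSEQ_subseq_LIMSEQ[OF _ s] by (auto simp: o_def)
  qed simp
  finally have le: "(\<integral>\<^sup>+ x. ennreal (\<Psi> (f x - g x)) \<partial>M) \<le> ennreal m" .
  have err_int: "integrable M (\<lambda>x. \<Psi> (f x - g x))"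
    by (rule integrableI_nonneg) (use le in \<open>auto simp: \<Psi>_nonneg intro: le_less_trans\<close>)
  have "integrable M (\<lambda>x. \<Psi> (f x - (f x - g x)))"
    by (rule integrable_\<Psi>_diff[OF _ _ f_integrable err_int]) measurable
  then have g_adm: "admissible g"
    using g_mono g_meas by (simp add: admissible_def)
  have "0 \<le> m" unfolding m_def using zero err_nonneg by (intro cInf_greatest) auto
  have "err g \<le> m"
    using le \<open>0 \<le> m\<close> unfolding err_def
    by (subst (asm) nn_integral_eq_integral[OF err_int]) (auto simp: \<Psi>_nonneg)
  then show ?thesis using g_adm m_le by (auto simp: optimal_def intro: order_trans)
qed

end

section \<open>Passage to function classes\<close>

lemma smooth_gauge_integral:
  fixes \<Phi> \<phi> :: "real \<Rightarrow> real"
  assumes nonneg: "\<forall>t\<ge>0. 0 \<le> \<phi> t" and mono: "mono_on {0..} \<phi>" and cont: "continuous_on {0..} \<phi>"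
    and pos: "\<forall>t>0. 0 < \<phi> t" and lim: "(\<phi> \<longlongrightarrow> 0) (at_right 0)"
    and \<Phi>: "\<forall>x\<ge>0. \<Phi> x = integral {0..x} \<phi>"
    and K: "\<forall>x\<ge>0. \<Phi> (2 * x) \<le> K * \<Phi> x"
  shows "smooth_gauge (\<lambda>x. \<Phi> \<bar>x\<bar>) (\<lambda>x. if 0 \<le> x then \<phi> x else - \<phi> (- x)) K"
proof
  let ?\<psi> = "\<lambda>x. if 0 \<le> x then \<phi> x else - \<phi> (- x)"
  have "(\<phi> \<longlongrightarrow> \<phi> 0) (at 0 within {0..})" using cont by (simp add: continuous_on_def)
  then have "(\<phi> \<longlongrightarrow> \<phi> 0) (at_right 0)" by (rule tendsto_within_subset) auto
  then have \<phi>0: "\<phi> 0 = 0" using lim by (rule tendsto_unique[OF trivial_limit_at_right_real])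
  have int: "\<phi> integrable_on {u..v}" if "0 \<le> u" for u v
    using that by (intro integrable_continuous_interval continuous_on_subset[OF cont]) auto
  have split: "\<Phi> y = \<Phi> x + integral {x..y} \<phi>" if "0 \<le> x" "x \<le> y" for x y
    using \<Phi> that int by (simp add: Henstock_Kurzweil_Integration.integral_combine)
  have sub: "\<Phi> x + \<phi> x * (y - x) \<le> \<Phi> y" if "0 \<le> x" "0 \<le> y" for x y
  proof (cases "x \<le> y")
    case True
    have "integral {x..y} (\<lambda>_. \<phi> x) \<le> integral {x..y} \<phi>"
      using mono int that by (intro integral_le) (auto elim: mono_onD)
    then show ?thesis using split[OF that(1) True] True by (simp add: mult.commute)
  next
    case False
    have "integral {y..x} \<phi> \<le> integral {y..x} (\<lambda>_. \<phi> x)"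
      using mono int that by (intro integral_le) (auto elim: mono_onD)
    then show ?thesis using split[of y x] that False by (simp add: algebra_simps)
  qed
  show "\<Phi> \<bar>x\<bar> + ?\<psi> x * (y - x) \<le> \<Phi> \<bar>y\<bar>" for x y
  proof -
    have "?\<psi> x * (y - x) \<le> \<phi> \<bar>x\<bar> * (\<bar>y\<bar> - \<bar>x\<bar>)"
    proof (cases "0 \<le> x")
      case True
      then have "\<phi> x * (y - x) \<le> \<phi> x * (\<bar>y\<bar> - x)"
        using nonneg by (intro mult_left_mono) auto
      then show ?thesis using True by simp
    next
      case False
      have "\<phi> (- x) * (x - y) \<le> \<phi> (- x) * (\<bar>y\<bar> - \<bar>x\<bar>)"
        using False nonneg by (intro mult_left_mono) auto
      moreover have "- \<phi> (- x) * (y - x) = \<phi> (- x) * (x - y)" by (simp add: right_diff_distrib)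
      moreover have "\<bar>x\<bar> = - x" using False by simp
      ultimately show ?thesis using False by (simp only: if_False)
    qed
    moreover have "\<Phi> \<bar>x\<bar> + \<phi> \<bar>x\<bar> * (\<bar>y\<bar> - \<bar>x\<bar>) \<le> \<Phi> \<bar>y\<bar>"
      by (rule sub) simp_all
    ultimately show ?thesis by linarith
  qed
  have "continuous_on ({0..} \<union> {..0}) ?\<psi>"
  proof (rule continuous_on_cases)
    show "continuous_on {..0} (\<lambda>x. - \<phi> (- x))"
      by (intro continuous_intros continuous_on_compose2[OF cont]) auto
  qed (use cont \<phi>0 in auto)
  moreover have "{0..} \<union> {..0} = (UNIV :: real set)" by auto
  ultimately show "continuous_on UNIV ?\<psi>" by simp
  show "?\<psi> x = 0 \<longleftrightarrow> x = 0" for x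
    using pos[rule_format, of x] pos[rule_format, of "- x"] \<phi>0
    by (cases x "0 :: real" rule: linorder_cases) simp_all
  show "\<Phi> \<bar>0\<bar> = 0" using \<Phi> by simp
  show "\<Phi> \<bar>- x\<bar> = \<Phi> \<bar>x\<bar>" for x by simp
  show "\<Phi> \<bar>2 * x\<bar> \<le> K * \<Phi> \<bar>x\<bar>" for x
    using K[rule_format, of "\<bar>x\<bar>"] by (simp add: abs_mult)
qed

text \<open>
  Only the values of \<open>\<Phi>\<close> on \<open>[0,\<infinity>)\<close> matter, so \<open>\<Phi>\<close> may be replaced by its even reflection.
\<close>

lemma best_approximants_abs: "best_approximants a b (\<lambda>x. \<Phi> \<bar>x\<bar>) f = best_approximants a b \<Phi> f"
  by (simp add: best_approximants_def M_Phi_def L_Phi_def modular_def)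

context monotone_approximation
begin

lemma modular_eq_integral:
  assumes "integrable M (\<lambda>x. \<Psi> (g x))"
  shows "modular a b \<Psi> g = ennreal (LINT x|M. \<Psi> (g x))"
  unfolding modular_def \<Psi>_abs by (rule nn_integral_eq_integral[OF assms]) (simp add: \<Psi>_nonneg)

lemma L_Phi_iff: "g \<in> L_Phi a b \<Psi> \<longleftrightarrow> g \<in> borel_measurable M \<and> integrable M (\<lambda>x. \<Psi> (g x))"
proof
  assume g: "g \<in> L_Phi a b \<Psi>"
  then have [measurable]: "g \<in> borel_measurable M" by (simp add: L_Phi_def)
  have "integrable M (\<lambda>x. \<Psi> (g x))"
    by (rule integrableI_nonneg) (use g in \<open>auto simp: L_Phi_def modular_def \<Psi>_abs \<Psi>_nonneg\<close>)
  then show "g \<in> borel_measurable M \<and> integrable M (\<lambda>x. \<Psi> (g x))" by simp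
next
  assume "g \<in> borel_measurable M \<and> integrable M (\<lambda>x. \<Psi> (g x))"
  then show "g \<in> L_Phi a b \<Psi>" by (simp add: L_Phi_def modular_eq_integral)
qed

text \<open>
  Setting a monotone representative to \<open>0\<close> at and beyond the end points makes it measurable and
  changes it on a null set only.
\<close>

lemma M_Phi_iff:
  "g \<in> M_Phi a b \<Psi> \<longleftrightarrow> g \<in> borel_measurable M \<and> (\<exists>h. admissible h \<and> (AE x in M. g x = h x))"
proof
  assume g: "g \<in> M_Phi a b \<Psi>"
  then obtain h0 where h0: "mono_on {a<..<b} h0" "AE x in M. g x = h0 x" by (auto simp: M_Phi_def)
  have g_meas: "g \<in> borel_measurable M" and g_int: "integrable M (\<lambda>x. \<Psi> (g x))"
    using g L_Phi_iff by (auto simp: M_Phi_def)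
  define h where "h x = (if x \<in> {a<..<b} then h0 x else 0)" for x
  have h_meas: "h \<in> borel_measurable M"
    unfolding h_def[abs_def] using h0(1) by (rule mono_on_extension_borel_measurable)
  have ae: "AE x in M. g x = h x"
    using h0(2) mono_on_AE_isCont[OF h0(1)] by eventually_elim (simp add: h_def)
  then have "AE x in M. \<Psi> (g x) = \<Psi> (h x)" by eventually_elim simp
  then have "integrable M (\<lambda>x. \<Psi> (h x))"
    by (rule integrable_cong_AE_imp[OF g_int \<Psi>_measurable[OF h_meas]])
  moreover have "mono_on {a<..<b} h" using h0(1) by (auto simp: h_def mono_on_def)
  ultimately show "g \<in> borel_measurable M \<and> (\<exists>h. admissible h \<and> (AE x in M. g x = h x))"
    using g_meas h_meas ae by (auto simp: admissible_def)
next
  assume "g \<in> borel_measurable M \<and> (\<exists>h. admissible h \<and> (AE x in M. g x = h x))"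
  then obtain h where g_meas [measurable]: "g \<in> borel_measurable M"
    and h: "admissible h" and ae: "AE x in M. g x = h x" by blast
  have "integrable M (\<lambda>x. \<Psi> (g x))"
  proof (rule integrable_cong_AE_imp)
    show "integrable M (\<lambda>x. \<Psi> (h x))" using h by (simp add: admissible_def)
    show "AE x in M. \<Psi> (h x) = \<Psi> (g x)" using ae by eventually_elim simp
  qed measurable
  then show "g \<in> M_Phi a b \<Psi>"
    using g_meas h ae by (auto simp: M_Phi_def L_Phi_iff admissible_def)
qed

lemma modular_residual:
  assumes g [measurable]: "g \<in> borel_measurable M" and h: "admissible h" and ae: "AE x in M. g x = h x"
  shows "modular a b \<Psi> (\<lambda>x. f x - g x) = ennreal (err h)"
proof -
  have "modular a b \<Psi> (\<lambda>x. f x - g x) = modular a b \<Psi> (\<lambda>x. f x - h x)"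
    unfolding modular_def by (rule nn_integral_cong_AE) (use ae in \<open>eventually_elim, simp\<close>)
  then show ?thesis
    using modular_eq_integral[OF admissible_err_integrable[OF h]] by (simp add: err_def)
qed

lemma best_approximants_iff:
  "g \<in> best_approximants a b \<Psi> f \<longleftrightarrow>
    g \<in> borel_measurable M \<and> (\<exists>h. optimal h \<and> (AE x in M. g x = h x))" (is "?L \<longleftrightarrow> ?R")
proof -
  have min: "?L \<longleftrightarrow> g \<in> M_Phi a b \<Psi> \<and> (\<forall>k\<in>M_Phi a b \<Psi>.
      modular a b \<Psi> (\<lambda>x. f x - g x) \<le> modular a b \<Psi> (\<lambda>x. f x - k x))"
    unfolding best_approximants_def
    by (auto intro!: antisym INF_greatest INF_lower2[of g] INF_lower)
  have adm_M: "k \<in> M_Phi a b \<Psi>" if "admissible k" for k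
    using that unfolding M_Phi_iff by (auto simp: admissible_def)
  show ?thesis
  proof
    assume ?L
    then have g: "g \<in> M_Phi a b \<Psi>" and le: "\<And>k. k \<in> M_Phi a b \<Psi> \<Longrightarrow>
        modular a b \<Psi> (\<lambda>x. f x - g x) \<le> modular a b \<Psi> (\<lambda>x. f x - k x)"
      by (auto simp: min)
    obtain h where h: "admissible h" "AE x in M. g x = h x" and gm: "g \<in> borel_measurable M"
      using g M_Phi_iff by blast
    have "err h \<le> err k" if k: "admissible k" for k
    proof -
      have "ennreal (err h) \<le> ennreal (err k)"
        using le[OF adm_M[OF k]] modular_residual[OF gm h] modular_residual[of k k] k
        by (simp add: admissible_def)
      then show ?thesis by (simp add: ennreal_le_iff err_nonneg)
    qed
    then show ?R using h gm by (auto simp: optimal_def)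
  next
    assume ?R
    then obtain h where h: "optimal h" and ae: "AE x in M. g x = h x" and gm: "g \<in> borel_measurable M"
      by blast
    have h_adm: "admissible h" using h by (simp add: optimal_def)
    show ?L
      unfolding min
    proof (intro conjI ballI)
      show "g \<in> M_Phi a b \<Psi>" unfolding M_Phi_iff using gm h_adm ae by blast
      fix k assume "k \<in> M_Phi a b \<Psi>"
      then obtain k' where k: "k \<in> borel_measurable M" "admissible k'" "AE x in M. k x = k' x"
        using M_Phi_iff by blast
      have "err h \<le> err k'" using h k by (simp add: optimal_def)
      then show "modular a b \<Psi> (\<lambda>x. f x - g x) \<le> modular a b \<Psi> (\<lambda>x. f x - k x)"
        using modular_residual[OF gm h_adm ae] modular_residual[OF k] by (simp add: ennreal_leI)
    qed
  qed
qed

theorem best_approximants_singleton: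
  assumes ac: "\<And>x. x \<in> {a<..<b} \<Longrightarrow> approx_continuous_at a b f x"
  shows "is_singleton (best_approximants a b \<Psi> f // ae_equal a b)"
proof -
  obtain h where h: "optimal h" using optimal_exists by blast
  have h_meas: "h \<in> borel_measurable M" using h by (simp add: optimal_def admissible_def)
  have eq: "AE x in M. g x = h x" and meas: "g \<in> borel_measurable M"
    if g: "g \<in> best_approximants a b \<Psi> f" for g
  proof -
    obtain k where k: "optimal k" "AE x in M. g x = k x" and "g \<in> borel_measurable M"
      using g best_approximants_iff by blast
    then show "g \<in> borel_measurable M" by simp
    have "AE x in M. k x = h x" by (rule optimal_unique[OF k(1) h]) (rule ac)
    with k(2) show "AE x in M. g x = h x" by eventually_elim simp
  qed
  have cls: "ae_equal a b `` {g} = ae_equal a b `` {h}" if g: "g \<in> best_approximants a b \<Psi> f" for g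
  proof -
    have "(AE x in M. g x = k x) \<longleftrightarrow> (AE x in M. h x = k x)" for k
      by (rule eventually_subst) (use eq[OF g] in \<open>eventually_elim, simp\<close>)
    then show ?thesis using meas[OF g] h_meas by (auto simp: ae_equal_def)
  qed
  show ?thesis
  proof (rule is_singletonI')
    have "h \<in> best_approximants a b \<Psi> f" using h h_meas best_approximants_iff by auto
    then have "ae_equal a b `` {h} \<in> best_approximants a b \<Psi> f // ae_equal a b" by (rule quotientI)
    then show "best_approximants a b \<Psi> f // ae_equal a b \<noteq> {}" by (simp only: ex_in_conv[symmetric]) (rule exI)
    fix X Y
    assume X: "X \<in> best_approximants a b \<Psi> f // ae_equal a b"
      and Y: "Y \<in> best_approximants a b \<Psi> f // ae_equal a b"
    obtain g1 where g1: "X = ae_equal a b `` {g1}" "g1 \<in> best_approximants a b \<Psi> f"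
      using X by (rule quotientE)
    obtain g2 where g2: "Y = ae_equal a b `` {g2}" "g2 \<in> best_approximants a b \<Psi> f"
      using Y by (rule quotientE)
    show "X = Y"
      using cls[OF g1(2)] cls[OF g2(2)] unfolding g1(1) g2(1) by (rule trans[OF _ sym])
  qed
qed

end

theorem theorem4p3:
  fixes a b :: real and \<Phi> f :: "real \<Rightarrow> real"
  assumes "a < b"
    and "Delta2 \<Phi>"
    and "(N_function \<Phi> \<and> f \<in> L_inf a b) \<or> (N_inf_function \<Phi> \<and> f \<in> L_Phi a b \<Phi>)"
    and "f \<notin> M_Phi a b \<Phi>"
    and "\<forall>x\<in>{a<..<b}. approx_continuous_at a b f x"
  shows "is_singleton (best_approximants a b \<Phi> f // ae_equal a b)"
proof -
  obtain K where K: "\<forall>x\<ge>0. \<Phi> (2 * x) \<le> K * \<Phi> x" using assms(2) by (auto simp: Delta2_def)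
  obtain \<phi> where \<phi>: "\<forall>t\<ge>0. 0 \<le> \<phi> t" "mono_on {0..} \<phi>" "continuous_on {0..} \<phi>"
    "\<forall>t>0. 0 < \<phi> t" "(\<phi> \<longlongrightarrow> 0) (at_right 0)" "\<forall>x\<ge>0. \<Phi> x = integral {0..x} \<phi>"
    using assms(3) by (auto simp: N_function_def N_inf_function_def class_F_def class_F_inf_def)
  let ?\<Psi> = "\<lambda>x. \<Phi> \<bar>x\<bar>" and ?\<psi> = "\<lambda>x. if 0 \<le> x then \<phi> x else - \<phi> (- x)"
  interpret smooth_gauge ?\<Psi> ?\<psi> K by (rule smooth_gauge_integral[OF \<phi> K])
  let ?M = "lebesgue_on {a..b}"
  have f_meas [measurable]: "f \<in> borel_measurable ?M"
    using assms(3) by (auto simp: L_inf_def L_Phi_def)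
  have "integrable ?M (\<lambda>x. ?\<Psi> (f x))"
    using assms(3)
  proof (elim disjE conjE)
    assume "f \<in> L_inf a b"
    then obtain C where C: "AE x in ?M. \<bar>f x\<bar> \<le> C" by (auto simp: L_inf_def)
    interpret finite_measure ?M by (rule finite_measure_lebesgue_on) auto
    show ?thesis
    proof (rule Bochner_Integration.integrable_bound)
      show "integrable ?M (\<lambda>_. ?\<Psi> C)" by simp
      show "AE x in ?M. norm (?\<Psi> (f x)) \<le> norm (?\<Psi> C)"
        using C
      proof eventually_elim
        case (elim x)
        then have "\<bar>f x\<bar> \<le> \<bar>C\<bar>" by simp
        then show ?case
          unfolding real_norm_def abs_of_nonneg[OF \<Psi>_nonneg] by (rule \<Psi>_mono_abs)
      qed
    qed (rule \<Psi>_measurable[OF f_meas])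
  next
    assume "f \<in> L_Phi a b \<Phi>"
    then show ?thesis
      using \<Psi>_measurable[OF f_meas] \<Psi>_nonneg
      by (intro integrableI_nonneg) (auto simp: L_Phi_def modular_def)
  qed
  then interpret monotone_approximation ?\<Psi> ?\<psi> K a b f
    using assms(1) by unfold_locales auto
  show ?thesis
    using best_approximants_singleton assms(5) unfolding best_approximants_abs by blast
qed

end
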